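(* Let $\mathbb F_q$ be a finite field, $t\ge 1$ and $n\ge 1$. Set $d := \left\lceil \frac{(2t-1)\log n}{\log q}+2t-1\right\rceil$ (so that $n\le q^{(d-(2t-1))/(2t-1)}$). Then one can construct a $t$-term linearly independent set $S\subseteq \mathbb F_q^d$ with $|S|=n$ in time polynomial in $n^t+q^t$.
   Context: For a finite field $\mathbb F$ and $t\ge 1$, a subset $S\subseteq \mathbb F^d$ is \emph{$t$-term linearly independent} if every subset $S'\subseteq S$ with $|S'|\le t$ is linearly independent. *)

theory Defs
  imports
    Complex_Main
    "HOL-Computational_Algebra.Polynomial"
    "Jordan_Normal_Form.Matrix"
    "Jordan_Normal_Form.Missing_VectorSpace"
begin

section \<open>Term-wise linear independence in a coordinate space\<close>

text \<open>
  The coordinate space of dimension \<open>d\<close> over a field given as a record.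
  The fields \<open>mult\<close> and \<open>one\<close> belong to the module record but play no role in a module.
\<close>

definition coord_space :: "'a ring \<Rightarrow> nat \<Rightarrow> ('a, 'a vec) module" where
  "coord_space F d =
    \<lparr> carrier = {v. dim_vec v = d \<and> (\<forall>j<d. v $ j \<in> carrier F)},
      mult = undefined,
      one = undefined,
      zero = vec d (\<lambda>j. \<zero>\<^bsub>F\<^esub>),
      add = (\<lambda>v w. vec d (\<lambda>j. v $ j \<oplus>\<^bsub>F\<^esub> w $ j)),
      smult = (\<lambda>c v. vec d (\<lambda>j. c \<otimes>\<^bsub>F\<^esub> v $ j)) \<rparr>"

lemma vectorspace_coord_space:
  assumes "field F"
  shows "vectorspace F (coord_space F d)"
proof -
  interpret F: field F by (fact assms)
  have "abelian_group (coord_space F d)"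
  proof (rule abelian_groupI)
    fix v assume v: "v \<in> carrier (coord_space F d)"
    then show "\<exists>w\<in>carrier (coord_space F d). w \<oplus>\<^bsub>coord_space F d\<^esub> v = \<zero>\<^bsub>coord_space F d\<^esub>"
      by (intro bexI[of _ "vec d (\<lambda>j. \<ominus>\<^bsub>F\<^esub> v $ j)"])
         (auto simp: coord_space_def F.l_neg)
  qed (auto simp: coord_space_def F.a_ac)
  then have "module F (coord_space F d)"
    by (intro module.intro module_axioms.intro F.is_cring)
       (auto simp: coord_space_def F.l_distr F.r_distr F.m_assoc)
  then show ?thesis
    by (intro vectorspace.intro assms)
qed

definition term_lin_indpt :: "'a ring \<Rightarrow> nat \<Rightarrow> nat \<Rightarrow> 'a vec set \<Rightarrow> bool" where
  "term_lin_indpt F d t S \<longleftrightarrow>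
    S \<subseteq> carrier (coord_space F d) \<and>
    (\<forall>S'. S' \<subseteq> S \<and> finite S' \<and> card S' \<le> t \<longrightarrow> \<not> module.lin_dep F (coord_space F d) S')"


section \<open>A machine model with running times\<close>

text \<open>
  Algorithms are while programs over a random access memory of natural numbers. The memory is
  organised in named unbounded arrays; an array that is only used at index 0 serves as a scalar
  variable. A program mentions only finitely many array names, so this is the usual random access
  machine up to interleaving.

  Every operation has unit cost. The only arithmetic operations are addition and truncated
  subtraction: one operation increases the bit length of the largest number in memory by at most
  one, so polynomial time in this model is polynomial time on Turing machines (with
  multiplication as a unit-cost operation it would not be).
\<close>

type_synonym name = string
type_synonym state = "name \<Rightarrow> nat \<Rightarrow> nat"

datatype exp =
    Const nat
  | Read name exp
  | Plus exp exp
  | Minus exp exp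

fun eval_exp :: "exp \<Rightarrow> state \<Rightarrow> nat" where
  "eval_exp (Const k) s = k"
| "eval_exp (Read x e) s = s x (eval_exp e s)"
| "eval_exp (Plus e f) s = eval_exp e s + eval_exp f s"
| "eval_exp (Minus e f) s = eval_exp e s - eval_exp f s"

fun cost_exp :: "exp \<Rightarrow> nat" where
  "cost_exp (Const k) = 1"
| "cost_exp (Read x e) = 1 + cost_exp e"
| "cost_exp (Plus e f) = 1 + cost_exp e + cost_exp f"
| "cost_exp (Minus e f) = 1 + cost_exp e + cost_exp f"

datatype com =
    Skip
  | Write name exp exp
  | Seq com com
  | Cond exp com com
  | While exp com

definition store :: "name \<Rightarrow> nat \<Rightarrow> nat \<Rightarrow> state \<Rightarrow> state" where
  "store x i a s = s(x := (s x)(i := a))"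

text \<open>
  \<open>exec c s k s'\<close>: started in \<open>s\<close>, the program \<open>c\<close> terminates in \<open>s'\<close> after exactly \<open>k\<close> time units.
  Conditions are true when their value is not 0.
\<close>

inductive exec :: "com \<Rightarrow> state \<Rightarrow> nat \<Rightarrow> state \<Rightarrow> bool" where
  Skip: "exec Skip s 1 s"
| Write: "exec (Write x i e) s (1 + cost_exp i + cost_exp e)
    (store x (eval_exp i s) (eval_exp e s) s)"
| Seq: "exec c s k s' \<Longrightarrow> exec c' s' k' s'' \<Longrightarrow> exec (Seq c c') s (k + k') s''"
| CondTrue: "eval_exp b s \<noteq> 0 \<Longrightarrow> exec c s k s' \<Longrightarrow> exec (Cond b c c') s (1 + cost_exp b + k) s'"
| CondFalse: "eval_exp b s = 0 \<Longrightarrow> exec c' s k s' \<Longrightarrow> exec (Cond b c c') s (1 + cost_exp b + k) s'"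
| WhileFalse: "eval_exp b s = 0 \<Longrightarrow> exec (While b c) s (1 + cost_exp b) s"
| WhileTrue: "eval_exp b s \<noteq> 0 \<Longrightarrow> exec c s k s' \<Longrightarrow> exec (While b c) s' k' s'' \<Longrightarrow>
    exec (While b c) s (1 + cost_exp b + k + k') s''"

inductive_cases exec_SkipE: "exec Skip s k s'"
inductive_cases exec_WriteE: "exec (Write x i e) s k s'"
inductive_cases exec_SeqE: "exec (Seq c c') s k s'"
inductive_cases exec_CondE: "exec (Cond b c c') s k s'"
inductive_cases exec_WhileE: "exec (While b c) s k s'"

lemma exec_deterministic:
  "exec c s k s' \<Longrightarrow> exec c s l s'' \<Longrightarrow> l = k \<and> s'' = s'"
proof (induction arbitrary: l s'' rule: exec.induct)
  case (Seq c s k s' c' k' s3)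
  from Seq.prems show ?case
  proof (rule exec_SeqE)
    fix l1 r l2 assume "l = l1 + l2" "exec c s l1 r" "exec c' r l2 s''"
    with Seq.IH show ?thesis by metis
  qed
next
  case (WhileTrue b s c k s' k' s3)
  from WhileTrue.prems show ?case
  proof (rule exec_WhileE)
    fix l1 r l2
    assume l: "l = Suc (cost_exp b + l1 + l2)" and 1: "exec c s l1 r" and 2: "exec (While b c) r l2 s''"
    from WhileTrue.IH(1)[OF 1] have "l1 = k" "r = s'" by auto
    moreover from this 2 have "l2 = k'" "s'' = s3" using WhileTrue.IH(2) by blast+
    ultimately show ?thesis using l by simp
  qed (use WhileTrue.hyps in simp)
next
  case (Skip s)
  from Skip.prems show ?case by (rule exec_SkipE) simp
next
  case (Write x i e s)
  from Write.prems show ?case by (rule exec_WriteE) simp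
next
  case (CondTrue b s c k s' c')
  from CondTrue.prems show ?case
  proof (rule exec_CondE)
    fix l' assume l: "l = Suc (cost_exp b + l')" and 1: "exec c s l' s''"
    from CondTrue.IH[OF 1] l show ?thesis by simp
  qed (use CondTrue.hyps in simp)
next
  case (CondFalse b s c' k s' c)
  from CondFalse.prems show ?case
  proof (rule exec_CondE)
    fix l' assume l: "l = Suc (cost_exp b + l')" and 1: "exec c' s l' s''"
    from CondFalse.IH[OF 1] l show ?thesis by simp
  qed (use CondFalse.hyps in simp)
next
  case (WhileFalse b s c)
  from WhileFalse.prems show ?case
    by (rule exec_WhileE) (use WhileFalse.hyps in simp_all)
qed


section \<open>Input and output\<close>

text \<open>
  A finite field with \<open>q\<close> elements is presented to a program by its addition and multiplication
  tables, its elements being the numbers below \<open>q\<close> (in any order: 0 and 1 need not be the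
  neutral elements). All other memory cells are initially 0.
\<close>

definition input :: "nat ring \<Rightarrow> nat \<Rightarrow> nat \<Rightarrow> nat \<Rightarrow> state" where
  "input F q t n = (\<lambda>x i.
     if x = ''q'' \<and> i = 0 then q
     else if x = ''t'' \<and> i = 0 then t
     else if x = ''n'' \<and> i = 0 then n
     else if x = ''add'' \<and> i < q * q then (i div q) \<oplus>\<^bsub>F\<^esub> (i mod q)
     else if x = ''mul'' \<and> i < q * q then (i div q) \<otimes>\<^bsub>F\<^esub> (i mod q)
     else 0)"

text \<open>The \<open>n\<close> output vectors of length \<open>d\<close> are stored one after the other in the array \<open>S\<close>.\<close>

definition output_set :: "state \<Rightarrow> nat \<Rightarrow> nat \<Rightarrow> nat vec set" where
  "output_set s n d = (\<lambda>i. vec d (\<lambda>j. s ''S'' (i * d + j))) ` {..<n}"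

end

theory Submission
  imports Defs
begin

text \<open>
  Vectors of \<open>F\<^sup>d\<close> are coded by the numbers below \<open>q\<^sup>d\<close>, and \<open>q\<^sup>d\<close> lies between \<open>(n q)\<^sup>2\<^sup>t\<^sup>-\<^sup>1\<close> and
  \<open>q (n q)\<^sup>2\<^sup>t\<^sup>-\<^sup>1\<close>, which is polynomial in \<open>n\<^sup>t + q\<^sup>t\<close>. Hence a table over the whole space is affordable, and the
  vectors can be chosen greedily: each new one avoids all combinations of at most \<open>t\<close> earlier ones.
  With \<open>i < n\<close> earlier vectors there are at most \<open>(1 + i q)\<^sup>t < (n q)\<^sup>t \<le> q\<^sup>d\<close> such combinations, so a choice
  exists. In a dependency among at most \<open>t + 1\<close> of the chosen vectors the last one would be a
  combination of at most \<open>t\<close> earlier ones. After each choice \<open>v\<close>, dynamic programming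
  updates for all \<open>x\<close> the least length of a combination equal to \<open>-x\<close>, by looking at all \<open>x + c v\<close>.
\<close>

section \<open>Running times of while programs\<close>

text \<open>Since \<open>t\<close> is an input of one fixed program, enumerating combinations
  directly would take loops nested \<open>t\<close> deep; the table replaces them by one sweep per
  chosen vector, in which that vector receives its coefficient. Working with \<open>-x\<close> means
  asking what must be added to \<open>x\<close> to reach zero: the field comes only with tables for
  addition and multiplication, so no negation is ever computed, and since the scalars run through
  the whole field the sign does not affect which vectors are free. The machine can only add and
  subtract, so products, quotients and digits are obtained by counting. This costs time linear in
  the numbers, which is affordable because every loop runs fewer than \<open>K\<close> times for a
  single \<open>K\<close> exceeding \<open>q ^ d\<close>.\<close>

fun mods :: "com \<Rightarrow> name set" where
  "mods Skip = {}"
| "mods (Write x i e) = {x}"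
| "mods (Seq c c') = mods c \<union> mods c'"
| "mods (Cond b c c') = mods c \<union> mods c'"
| "mods (While b c) = mods c"

definition agree :: "name set \<Rightarrow> state \<Rightarrow> state \<Rightarrow> bool" where
  "agree X s s' \<longleftrightarrow> (\<forall>x. x \<notin> X \<longrightarrow> s' x = s x)"

lemma agreeD: "agree X s s' \<Longrightarrow> x \<notin> X \<Longrightarrow> s' x = s x"
  by (simp add: agree_def)

lemma store_same [simp]: "store x i a s x = (s x)(i := a)"
  and store_other [simp]: "y \<noteq> x \<Longrightarrow> store x i a s y = s y"
  by (simp_all add: store_def)

lemma exec_agree: "exec c s k s' \<Longrightarrow> agree (mods c) s s'"
  by (induction rule: exec.induct) (auto simp: agree_def store_def)

text \<open>A total-correctness triple whose \<open>T\<close> is only an upper bound, so that times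
  may be rounded up. The sequencing and consequence rules hand \<open>agree\<close> to the
  continuation as a frame, so a postcondition only has to mention what changes.\<close>

definition run :: "com \<Rightarrow> state \<Rightarrow> nat \<Rightarrow> (state \<Rightarrow> bool) \<Rightarrow> bool" where
  "run c s T Q \<longleftrightarrow> (\<exists>k s'. exec c s k s' \<and> k \<le> T \<and> Q s')"

lemma run_conseq:
  assumes "run c s T Q" "T \<le> T'"
    and "\<And>s'. agree (mods c) s s' \<Longrightarrow> Q s' \<Longrightarrow> Q' s'"
  shows "run c s T' Q'"
  using assms exec_agree unfolding run_def by (meson le_trans)

lemma run_Skip: "Q s \<Longrightarrow> run Skip s 1 Q"
  unfolding run_def using exec.Skip by blast

lemma run_Write:
  "Q (store x (eval_exp i s) (eval_exp e s) s) \<Longrightarrow> run (Write x i e) s (1 + cost_exp i + cost_exp e) Q"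
  unfolding run_def using exec.Write by blast

lemma run_Seq:
  assumes "run c s T R" "\<And>s'. agree (mods c) s s' \<Longrightarrow> R s' \<Longrightarrow> run c' s' T' Q"
  shows "run (Seq c c') s (T + T') Q"
proof -
  obtain k s' where 1: "exec c s k s'" "k \<le> T" "R s'"
    using assms(1) unfolding run_def by blast
  then obtain k' s'' where 2: "exec c' s' k' s''" "k' \<le> T'" "Q s''"
    using assms(2) exec_agree unfolding run_def by blast
  from exec.Seq[OF 1(1) 2(1)] add_mono[OF 1(2) 2(2)] 2(3) show ?thesis
    unfolding run_def by blast
qed

lemma run_Seq_Write:
  assumes "run c' (store x (eval_exp i s) (eval_exp e s) s) T' Q"
  shows "run (Seq (Write x i e) c') s (1 + cost_exp i + cost_exp e + T') Q"
proof -
  have "run (Write x i e) s (1 + cost_exp i + cost_exp e)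
      (\<lambda>s'. s' = store x (eval_exp i s) (eval_exp e s) s)"
    by (rule run_Write) simp
  then show ?thesis
    by (rule run_Seq) (use assms in simp)
qed

lemma run_le: "run c s T Q \<Longrightarrow> T \<le> T' \<Longrightarrow> run c s T' Q"
  by (rule run_conseq) auto

text \<open>Naming the stored values \<open>a\<close> and \<open>b\<close> keeps successor states
  free of unevaluated expressions when writes are chained.\<close>

lemma run_Write_then:
  assumes "run c' (store x a b s) T' Q" "eval_exp i s = a" "eval_exp e s = b"
  shows "run (Seq (Write x i e) c') s (1 + cost_exp i + cost_exp e + T') Q"
  by (rule run_Seq_Write) (use assms in simp)

lemma run_Cond:
  assumes "eval_exp b s \<noteq> 0 \<Longrightarrow> run c s T Q" "eval_exp b s = 0 \<Longrightarrow> run c' s T' Q"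
  shows "run (Cond b c c') s (1 + cost_exp b + T + T') Q"
proof (cases "eval_exp b s = 0")
  case True
  then obtain k s' where "exec c' s k s'" "k \<le> T'" "Q s'"
    using assms(2) unfolding run_def by blast
  moreover from this have "1 + cost_exp b + k \<le> 1 + cost_exp b + T + T'" by simp
  ultimately show ?thesis
    unfolding run_def using exec.CondFalse[OF True] by blast
next
  case False
  then obtain k s' where "exec c s k s'" "k \<le> T" "Q s'"
    using assms(1) unfolding run_def by blast
  moreover from this have "1 + cost_exp b + k \<le> 1 + cost_exp b + T + T'" by simp
  ultimately show ?thesis
    unfolding run_def using exec.CondTrue[OF False] by blast
qed

text \<open>The number \<open>m\<close> of rounds is fixed in advance and indexes the invariant, so
  termination needs no separate measure.\<close>

lemma run_While:
  assumes "I 0 s"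
    and step: "\<And>i s'. i < m \<Longrightarrow> agree (mods c) s s' \<Longrightarrow> I i s' \<Longrightarrow> eval_exp b s' \<noteq> 0 \<and> run c s' T (I (Suc i))"
    and final: "\<And>s'. agree (mods c) s s' \<Longrightarrow> I m s' \<Longrightarrow> eval_exp b s' = 0 \<and> Q s'"
  shows "run (While b c) s (m * (1 + cost_exp b + T) + (1 + cost_exp b)) Q"
proof -
  have "run (While b c) s' ((m - i) * (1 + cost_exp b + T) + (1 + cost_exp b)) Q"
    if "i \<le> m" "agree (mods c) s s'" "I i s'" for i s'
    using that
  proof (induction "m - i" arbitrary: i s')
    case 0
    then have "i = m" by simp
    with 0 final have "eval_exp b s' = 0" "Q s'" by blast+
    from exec.WhileFalse[OF this(1)] this(2) show ?case
      unfolding run_def by (meson le_add2)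
  next
    case (Suc l)
    then have "i < m" by simp
    with step Suc.prems obtain k u where b: "eval_exp b s' \<noteq> 0"
      and u: "exec c s' k u" "k \<le> T" "I (Suc i) u" unfolding run_def by blast
    have "agree (mods c) s u"
      using exec_agree[OF u(1)] Suc.prems by (simp add: agree_def)
    from Suc.hyps(1)[OF _ _ this u(3)] Suc.hyps(2) \<open>i < m\<close>
    obtain k' w where w: "exec (While b c) u k' w" "Q w"
      "k' \<le> (m - Suc i) * (1 + cost_exp b + T) + (1 + cost_exp b)" unfolding run_def by force
    have "1 + cost_exp b + k + k' \<le> Suc (m - Suc i) * (1 + cost_exp b + T) + (1 + cost_exp b)"
      using u(2) w(3) by simp
    then have "1 + cost_exp b + k + k' \<le> (m - i) * (1 + cost_exp b + T) + (1 + cost_exp b)"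
      using \<open>i < m\<close> by (simp only: Suc_diff_Suc)
    with exec.WhileTrue[OF b u(1) w(1)] w(2) show ?case unfolding run_def by blast
  qed
  from this[of 0 s] assms(1) show ?thesis by (simp add: agree_def)
qed

abbreviation var :: "name \<Rightarrow> exp" where "var x \<equiv> Read x (Const 0)"

abbreviation assign :: "name \<Rightarrow> exp \<Rightarrow> com" where "assign x e \<equiv> Write x (Const 0) e"

definition For :: "name \<Rightarrow> exp \<Rightarrow> com \<Rightarrow> com" where
  "For x e c = Seq (assign x (Const 0))
    (While (Minus e (var x)) (Seq c (assign x (Plus (var x) (Const 1)))))"

lemma mods_For [simp]: "mods (For x e c) = insert x (mods c)"
  by (auto simp: For_def)

text \<open>
  The number of iterations enters the bound only through some \<open>K\<close> exceeding it, so that the times of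
  nested loops become powers of one \<open>K\<close>.
\<close>

lemma run_For:
  assumes "x \<notin> mods c"
    and inv: "\<And>i s' a. I i (store x 0 a s') = I i s'"
    and bound: "\<And>s'. agree (insert x (mods c)) s s' \<Longrightarrow> eval_exp e s' = m"
    and init: "I 0 s"
    and step: "\<And>i s'. i < m \<Longrightarrow> agree (insert x (mods c)) s s' \<Longrightarrow> s' x 0 = i \<Longrightarrow> I i s' \<Longrightarrow>
      run c s' T (I (Suc i))"
    and final: "\<And>s'. agree (insert x (mods c)) s s' \<Longrightarrow> I m s' \<Longrightarrow> Q s'"
    and "m < K" "T + cost_exp e + 10 \<le> C"
  shows "run (For x e c) s (K * C) Q"
proof -
  let ?s0 = "store x 0 0 s"
  let ?c = "Seq c (assign x (Plus (var x) (Const 1)))"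
  have agree: "agree (insert x (mods c)) s s'" if "agree (mods ?c) ?s0 s'" for s'
    using that by (auto simp: agree_def)
  have loop: "run (While (Minus e (var x)) ?c) ?s0
     (m * (1 + cost_exp (Minus e (var x)) + (T + (1 + cost_exp (Const 0) +
        cost_exp (Plus (var x) (Const 1))))) + (1 + cost_exp (Minus e (var x)))) Q"
  proof (rule run_While[where I = "\<lambda>i s'. I i s' \<and> s' x 0 = i"])
    show "I 0 ?s0 \<and> ?s0 x 0 = 0" using init inv by simp
  next
    fix i s' assume i: "i < m" and ag: "agree (mods ?c) ?s0 s'" and I: "I i s' \<and> s' x 0 = i"
    have "eval_exp (Minus e (var x)) s' \<noteq> 0" using bound[OF agree[OF ag]] i I by simp
    moreover have "run ?c s' (T + (1 + cost_exp (Const 0) + cost_exp (Plus (var x) (Const 1))))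
        (\<lambda>s'. I (Suc i) s' \<and> s' x 0 = Suc i)"
    proof (rule run_Seq)
      show "run c s' T (I (Suc i))" using step[OF i agree[OF ag]] I by simp
    next
      fix s'' assume ag2: "agree (mods c) s' s''" and I2: "I (Suc i) s''"
      then have "s'' x 0 = i" using assms(1) I by (simp add: agree_def)
      then show "run (assign x (Plus (var x) (Const 1))) s''
          (1 + cost_exp (Const 0) + cost_exp (Plus (var x) (Const 1)))
          (\<lambda>s'. I (Suc i) s' \<and> s' x 0 = Suc i)"
        using I2 inv by (intro run_Write) simp
    qed
    ultimately show "eval_exp (Minus e (var x)) s' \<noteq> 0 \<and>
      run ?c s' (T + (1 + cost_exp (Const 0) + cost_exp (Plus (var x) (Const 1))))
        (\<lambda>s'. I (Suc i) s' \<and> s' x 0 = Suc i)" ..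
  next
    fix s' assume ag: "agree (mods ?c) ?s0 s'" and I: "I m s' \<and> s' x 0 = m"
    then show "eval_exp (Minus e (var x)) s' = 0 \<and> Q s'"
      using bound[OF agree[OF ag]] final[OF agree[OF ag]] by simp
  qed
  have "run (For x e c) s (m * (T + cost_exp e + 10) + (T + cost_exp e + 10)) Q"
    unfolding For_def
    by (rule run_le, rule run_Write_then, rule loop) (simp_all add: algebra_simps)
  \<comment> \<open>The initial assignment and the last, failing test are charged as one extra
    round, which makes \<open>Suc m\<close> \<le> \<open>K\<close> rounds.\<close>
  moreover have "m * (T + cost_exp e + 10) + (T + cost_exp e + 10) \<le> K * C"
    using mult_le_mono[OF Suc_leI[OF \<open>m < K\<close>] \<open>T + cost_exp e + 10 \<le> C\<close>] by simp
  ultimately show ?thesis by (rule run_le)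
qed

section \<open>Numerals as vectors\<close>

text \<open>
  The least significant digit comes first.
\<close>

fun undigits :: "nat \<Rightarrow> (nat \<Rightarrow> nat) \<Rightarrow> nat \<Rightarrow> nat" where
  "undigits q f 0 = 0"
| "undigits q f (Suc m) = f 0 + undigits q (\<lambda>j. f (Suc j)) m * q"

definition digit :: "nat \<Rightarrow> nat \<Rightarrow> nat \<Rightarrow> nat" where
  "digit q x j = x div q ^ j mod q"

lemma digit_less: "0 < q \<Longrightarrow> digit q x j < q"
  by (simp add: digit_def)

lemma undigits_less: "(\<And>j. j < m \<Longrightarrow> f j < q) \<Longrightarrow> undigits q f m < q ^ m"
proof (induction m arbitrary: f)
  case (Suc m)
  then have "Suc (undigits q (\<lambda>j. f (Suc j)) m) \<le> q ^ m" by (simp add: Suc_leI)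
  then have "Suc (undigits q (\<lambda>j. f (Suc j)) m) * q \<le> q ^ m * q" by (rule mult_le_mono1)
  moreover have "f 0 < q" using Suc.prems by simp
  ultimately show ?case by (simp add: mult.commute)
qed simp

lemma digit_undigits:
  "(\<And>j. j < m \<Longrightarrow> f j < q) \<Longrightarrow> j < m \<Longrightarrow> digit q (undigits q f m) j = f j"
proof (induction m arbitrary: f j)
  case (Suc m)
  have q: "f 0 < q" using Suc.prems by simp
  show ?case
  proof (cases j)
    case 0
    then show ?thesis using q by (simp add: digit_def)
  next
    case (Suc i)
    have "digit q (undigits q f (Suc m)) j = digit q (undigits q (\<lambda>j. f (Suc j)) m) i"
      using q by (simp add: digit_def Suc div_mult2_eq)
    also have "\<dots> = f j" using Suc.IH[of "\<lambda>j. f (Suc j)" i] Suc.prems Suc by simp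
    finally show ?thesis .
  qed
qed simp

lemma digit_0: "digit q x 0 = x mod q"
  and digit_Suc: "digit q x (Suc j) = digit q (x div q) j"
  by (simp_all add: digit_def div_mult2_eq)

lemma digits_eq_imp_eq:
  assumes "x < q ^ m" "y < q ^ m" "\<And>j. j < m \<Longrightarrow> digit q x j = digit q y j"
  shows "x = y"
  using assms
proof (induction m arbitrary: x y)
  case (Suc m)
  have "x div q < q ^ m" "y div q < q ^ m"
    using Suc.prems(1,2) by (metis less_mult_imp_div_less mult.commute power_Suc)+
  moreover have "digit q (x div q) j = digit q (y div q) j" if "j < m" for j
    using Suc.prems(3)[of "Suc j"] that unfolding digit_Suc by blast
  ultimately have "x div q = y div q" by (rule Suc.IH)
  moreover have "x mod q = y mod q" using Suc.prems(3)[of 0] unfolding digit_0 by blast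
  ultimately show ?case by (metis div_mult_mod_eq)
qed simp

section \<open>Subroutines\<close>

definition Mult :: "name \<Rightarrow> name \<Rightarrow> com" where
  "Mult x y = Seq (assign ''acc'' (Const 0)) (Seq
    (For ''cnt'' (var y) (assign ''acc'' (Plus (var ''acc'') (var x))))
    (assign x (var ''acc'')))"

lemma mods_Mult [simp]: "mods (Mult x y) = {''acc'', ''cnt'', x}"
  by (auto simp: Mult_def)

text \<open>Repeated addition: only the factor that counts the rounds has to be below
  \<open>K\<close>, so products such as table indices need no size bound.\<close>

lemma run_Mult:
  assumes "x \<noteq> ''acc''" "x \<noteq> ''cnt''" "y \<noteq> ''acc''" "y \<noteq> ''cnt''"
    and "s x 0 = a" "s y 0 = b" "b < K"
  shows "run (Mult x y) s (30 * K) (\<lambda>s'. s' x 0 = a * b)"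
proof -
  let ?s = "store ''acc'' 0 0 s"
  have loop: "run (For ''cnt'' (var y) (assign ''acc'' (Plus (var ''acc'') (var x)))) ?s
      (K * (7 + cost_exp (var y) + 10)) (\<lambda>s'. s' ''acc'' 0 = a * b)"
  proof (rule run_For[where I = "\<lambda>i s'. s' ''acc'' 0 = a * i"])
    fix i s'
    assume "agree (insert ''cnt'' (mods (assign ''acc'' (Plus (var ''acc'') (var x))))) ?s s'"
      and "s' ''acc'' 0 = a * i"
    then show "run (assign ''acc'' (Plus (var ''acc'') (var x))) s' 7 (\<lambda>s'. s' ''acc'' 0 = a * Suc i)"
      using assms by - (rule run_le, rule run_Write, auto simp: agree_def)
  qed (use assms in \<open>auto simp: agree_def\<close>)
  show ?thesis
    unfolding Mult_def
  proof (rule run_le, rule run_Write_then, rule run_Seq[OF loop])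
    fix s' :: state assume "s' ''acc'' 0 = a * b"
    then show "run (assign x (var ''acc'')) s' (1 + cost_exp (Const 0) + cost_exp (var ''acc'')) (\<lambda>s'. s' x 0 = a * b)"
      by (intro run_Write) auto
  qed (use assms(7) in auto)
qed

text \<open>Serves both as a step of Horner's rule and to form the index \<open>a * q + b\<close> of
  the operation tables, which code pairs as two-digit numerals.\<close>

definition Append :: "name \<Rightarrow> exp \<Rightarrow> com" where
  "Append x e = Seq (Mult x ''q'') (assign x (Plus (var x) e))"

lemma mods_Append [simp]: "mods (Append x e) = {''acc'', ''cnt'', x}"
  by (auto simp: Append_def)

lemma run_Append:
  assumes "x \<noteq> ''acc''" "x \<noteq> ''cnt''" "s ''q'' 0 = q" "q < K" "cost_exp e \<le> 10" "s x 0 = a"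
    and e: "\<And>s'. agree {''acc'', ''cnt'', x} s s' \<Longrightarrow> eval_exp e s' = b"
  shows "run (Append x e) s (50 * K) (\<lambda>s'. s' x 0 = a * q + b)"
  unfolding Append_def
proof (rule run_le, rule run_Seq[OF run_Mult])
  fix s' assume "agree (mods (Mult x ''q'')) s s'" and "s' x 0 = a * q"
  then show "run (assign x (Plus (var x) e)) s' (1 + cost_exp (Const 0) + cost_exp (Plus (var x) e))
      (\<lambda>s'. s' x 0 = a * q + b)"
    using e by (intro run_Write) auto
qed (use assms in auto)

text \<open>Division by \<open>q\<close> is done by counting up to \<open>num\<close>:
  \<open>rem\<close> runs cyclically through the residues and \<open>quo\<close> counts the
  wraparounds. A \<open>For\<close> loop re-evaluates its bound in every round, hence
  \<open>num\<close> is replaced only after the inner loop.\<close>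

definition Digits :: "name \<Rightarrow> name \<Rightarrow> com" where
  "Digits x X = Seq (assign ''num'' (var x))
    (For ''pos'' (var ''d'') (Seq (assign ''rem'' (Const 0)) (Seq (assign ''quo'' (Const 0)) (Seq
      (For ''sub'' (var ''num'') (Seq (assign ''rem'' (Plus (var ''rem'') (Const 1)))
        (Cond (Minus (var ''q'') (var ''rem'')) Skip
          (Seq (assign ''rem'' (Const 0)) (assign ''quo'' (Plus (var ''quo'') (Const 1)))))))
      (Seq (Write X (var ''pos'') (var ''rem'')) (assign ''num'' (var ''quo'')))))))"

lemma mods_Digits [simp]: "mods (Digits x X) = {''num'', ''pos'', ''rem'', ''quo'', ''sub'', X}"
  by (auto simp: Digits_def)

lemma run_divmod:
  assumes "s ''q'' 0 = q" "0 < q" "s ''num'' 0 = x" "s ''rem'' 0 = 0" "s ''quo'' 0 = 0" "x < K"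
  shows "run (For ''sub'' (var ''num'') (Seq (assign ''rem'' (Plus (var ''rem'') (Const 1)))
        (Cond (Minus (var ''q'') (var ''rem'')) Skip
          (Seq (assign ''rem'' (Const 0)) (assign ''quo'' (Plus (var ''quo'') (Const 1))))))) s
    (60 * K) (\<lambda>s'. s' ''rem'' 0 = x mod q \<and> s' ''quo'' 0 = x div q)"
    (is "run (For _ _ ?c) s _ ?Q")
proof -
  let ?I = "\<lambda>i s'. s' ''rem'' 0 = i mod q \<and> s' ''quo'' 0 = i div q"
  have "run (For ''sub'' (var ''num'') ?c) s (K * (35 + cost_exp (var ''num'') + 10)) ?Q"
  proof (rule run_For[where I = ?I])
    fix i s' assume ag: "agree (insert ''sub'' (mods ?c)) s s'" and I: "?I i s'"
    have q: "s' ''q'' 0 = q" using ag assms(1) by (simp add: agree_def)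
    let ?s = "store ''rem'' 0 (Suc (i mod q)) s'"
    have body: "run (Cond (Minus (var ''q'') (var ''rem'')) Skip
        (Seq (assign ''rem'' (Const 0)) (assign ''quo'' (Plus (var ''quo'') (Const 1))))) ?s 25 (?I (Suc i))"
    proof (rule run_conseq[OF run_Cond])
      show "run Skip ?s 1 (?I (Suc i))" if "eval_exp (Minus (var ''q'') (var ''rem'')) ?s \<noteq> 0"
        using that q I by (intro run_Skip) (auto simp: mod_Suc div_Suc)
      have "Suc (i mod q) = q" if "eval_exp (Minus (var ''q'') (var ''rem'')) ?s = 0"
        using that q mod_less_divisor[OF assms(2), of i] by (simp add: le_antisym)
      then show "run (Seq (assign ''rem'' (Const 0)) (assign ''quo'' (Plus (var ''quo'') (Const 1)))) ?s
          ((1 + cost_exp (Const 0) + cost_exp (Const 0)) + (1 + cost_exp (Const 0) + cost_exp (Plus (var ''quo'') (Const 1))))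
          (?I (Suc i))" if "eval_exp (Minus (var ''q'') (var ''rem'')) ?s = 0"
        using that I by (intro run_Seq_Write run_Write) (simp add: mod_Suc div_Suc)
    qed auto
    show "run ?c s' 35 (?I (Suc i))"
      by (rule run_le, rule run_Write_then, rule body) (use I in auto)
  qed (use assms in \<open>auto simp: agree_def\<close>)
  then show ?thesis using assms(6) by - (rule run_le, auto)
qed

lemma run_Digits:
  assumes names: "X \<notin> {''num'', ''pos'', ''rem'', ''quo'', ''sub'', ''d'', ''q''}"
    and "s ''q'' 0 = q" "0 < q" "s ''d'' 0 = d" "s x 0 = v" "d < K" "v < K"
  shows "run (Digits x X) s (100 * (K * K)) (\<lambda>s'. \<forall>j<d. s' X j = digit q v j)"
proof -
  let ?s = "store ''num'' 0 v s"
  let ?inner = "For ''sub'' (var ''num'') (Seq (assign ''rem'' (Plus (var ''rem'') (Const 1)))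
        (Cond (Minus (var ''q'') (var ''rem'')) Skip
          (Seq (assign ''rem'' (Const 0)) (assign ''quo'' (Plus (var ''quo'') (Const 1))))))"
  let ?end = "Seq (Write X (var ''pos'') (var ''rem'')) (assign ''num'' (var ''quo''))"
  let ?c = "Seq (assign ''rem'' (Const 0)) (Seq (assign ''quo'' (Const 0)) (Seq ?inner ?end))"
  let ?I = "\<lambda>i s'. s' ''num'' 0 = v div q ^ i \<and> (\<forall>j<i. s' X j = digit q v j)"
  have loop: "run (For ''pos'' (var ''d'') ?c) ?s (K * ((60 * K + 20) + cost_exp (var ''d'') + 10))
    (\<lambda>s'. \<forall>j<d. s' X j = digit q v j)"
  proof (rule run_For[where I = ?I])
    fix i s' assume ag: "agree (insert ''pos'' (mods ?c)) ?s s'" and pos: "s' ''pos'' 0 = i" and I: "?I i s'"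
    have q: "s' ''q'' 0 = q" using agreeD[OF ag, of "''q''"] names assms(2) by auto
    let ?s1 = "store ''quo'' 0 0 (store ''rem'' 0 0 s')"
    have "v div q ^ i < K" using assms(7) div_le_dividend le_less_trans by blast
    then have inner: "run ?inner ?s1 (60 * K)
        (\<lambda>s'. s' ''rem'' 0 = (v div q ^ i) mod q \<and> s' ''quo'' 0 = (v div q ^ i) div q)"
      using q I assms(3) by (intro run_divmod) auto
    have body: "run (Seq ?inner ?end) ?s1 (60 * K + 12) (?I (Suc i))"
    proof (rule run_le, rule run_Seq[OF inner])
      fix s'' assume ag2: "agree (mods ?inner) ?s1 s''"
        and s'': "s'' ''rem'' 0 = v div q ^ i mod q \<and> s'' ''quo'' 0 = v div q ^ i div q"
      have eq: "s'' ''pos'' 0 = i" "s'' X = s' X"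
        using ag2 pos names by (auto simp: agree_def)
      have "digit q v i = v div q ^ i mod q" "v div q ^ Suc i = v div q ^ i div q"
        by (simp_all add: digit_def div_mult2_eq[symmetric] mult.commute)
      then show "run ?end s'' ((1 + cost_exp (var ''pos'') + cost_exp (var ''rem'')) +
          (1 + cost_exp (Const 0) + cost_exp (var ''quo''))) (?I (Suc i))"
        using eq s'' I names by (intro run_Seq_Write run_Write) (auto simp: less_Suc_eq)
    qed auto
    show "run ?c s' (60 * K + 20) (?I (Suc i))"
      by (rule run_le, rule run_Write_then, rule run_Write_then, rule body) auto
  next
    fix s' assume ag: "agree (insert ''pos'' (mods ?c)) ?s s'"
    show "eval_exp (var ''d'') s' = d"
      using agreeD[OF ag, of "''d''"] names assms(4) by auto
  qed (use names assms(6) in auto)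
  have "K * (60 * K + 32) = 60 * (K * K) + 32 * K" "1 \<le> K" "K \<le> K * K"
    using assms(6) by (simp_all add: algebra_simps)
  then have "4 + K * (60 * K + 32) \<le> 100 * (K * K)" by linarith
  then have time: "1 + cost_exp (Const 0) + cost_exp (var x) +
      K * ((60 * K + 20) + cost_exp (var ''d'') + 10) \<le> 100 * (K * K)"
    by (simp add: algebra_simps)
  show ?thesis
    unfolding Digits_def
    by (rule run_le, rule run_Write_then, rule loop) (simp, use assms(5) in simp, rule time)
qed

section \<open>Combinations of few vectors\<close>

locale coded_field = field F for F :: "nat ring" (structure) +
  fixes q d t :: nat
  assumes carrier: "carrier F = {..<q}"
begin

definition translate :: "nat \<Rightarrow> nat \<Rightarrow> nat \<Rightarrow> nat" where
  "translate v c x = undigits q (\<lambda>j. digit q x j \<oplus> c \<otimes> digit q v j) d"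

definition zero_code :: nat where
  "zero_code = undigits q (\<lambda>_. \<zero>) d"

text \<open>
  For \<open>1 \<le> a \<le> t + 1\<close>, \<open>level V i a\<close> contains the \<open>x\<close> that become zero after adding a combination of at most
  \<open>t + 1 - a\<close> of the first \<open>i\<close> vectors. Counting down from \<open>t + 1\<close> lets the program represent all levels by
  one array, initially 0, that stores the largest \<open>a\<close> with \<open>x \<in> level V i a\<close>. Sums of length \<open>t\<close> rather than
  \<open>t - 1\<close> are excluded, which also makes the vectors distinct when \<open>t = 1\<close>.
\<close>

fun level :: "(nat \<Rightarrow> nat) \<Rightarrow> nat \<Rightarrow> nat \<Rightarrow> nat set" where
  "level V 0 a = (if a \<le> Suc t then {zero_code} else {})"
| "level V (Suc i) a = level V i a \<union> {x. x < q ^ d \<and> (\<exists>c<q. translate (V i) c x \<in> level V i (Suc a))}"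

lemma q_gt_1: "1 < q"
proof -
  have "\<zero> < q" "\<one> < q" using carrier zero_closed one_closed by auto
  then show ?thesis using zero_not_one by linarith
qed

lemma digit_closed [simp]: "digit q x j \<in> carrier F"
  using digit_less[of q] q_gt_1 carrier by simp

lemma mem_carrier: "x \<in> carrier F \<longleftrightarrow> x < q"
  by (simp add: carrier)

lemma digit_sum_less: "c < q \<Longrightarrow> digit q x j \<oplus> c \<otimes> digit q v j < q"
  unfolding mem_carrier[symmetric] by (intro a_closed m_closed digit_closed)

lemma translate_less: "c < q \<Longrightarrow> translate v c x < q ^ d"
  unfolding translate_def by (intro undigits_less digit_sum_less)

lemma digit_translate: "c < q \<Longrightarrow> j < d \<Longrightarrow> digit q (translate v c x) j = digit q x j \<oplus> c \<otimes> digit q v j"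
  unfolding translate_def by (intro digit_undigits digit_sum_less)

lemma zero_less_q: "\<zero> < q"
  using zero_closed mem_carrier by blast

lemma zero_code_less: "zero_code < q ^ d"
  unfolding zero_code_def by (intro undigits_less zero_less_q)

lemma digit_zero_code: "j < d \<Longrightarrow> digit q zero_code j = \<zero>"
  unfolding zero_code_def by (intro digit_undigits zero_less_q)

lemma level_cong: "(\<And>k. k < i \<Longrightarrow> V k = W k) \<Longrightarrow> level V i a = level W i a"
  by (induction i arbitrary: a) auto

lemma level_empty: "Suc t < a \<Longrightarrow> level V i a = {}"
  by (induction i arbitrary: a) auto

lemma finite_level: "finite (level V i a)"
  by (induction i arbitrary: a) auto

text \<open>Cancellation in each digit. It makes the preimage of a level under a translation no
  larger than the level, which drives the count below.\<close>

lemma inj_on_translate: "c < q \<Longrightarrow> inj_on (translate v c) {..<q ^ d}"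
proof (rule inj_onI, rule digits_eq_imp_eq[where m = d and q = q])
  fix x y j assume c: "c < q" and "translate v c x = translate v c y" and j: "j < d"
  then have "digit q x j \<oplus> c \<otimes> digit q v j = digit q y j \<oplus> c \<otimes> digit q v j"
    using digit_translate[OF c j] by metis
  moreover have "c \<in> carrier F" using c carrier by simp
  ultimately show "digit q x j = digit q y j"
    using add.right_cancel[OF m_closed[OF _ digit_closed] digit_closed digit_closed] by blast
qed auto

text \<open>Each of \<open>r\<close> slots is empty or holds one of at most \<open>i * q\<close>
  scalar multiples. The induction follows the recursion of \<open>level\<close> instead of counting
  words: one new vector adds at most \<open>q\<close> preimages of the next smaller case, and
  \<open>(1 + i * q) ^ r + q * (1 + i * q) ^ (r - 1)\<close> factors with
  \<open>1 + Suc i * q\<close>.\<close>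

lemma card_level: "r \<le> t \<Longrightarrow> card (level V i (Suc t - r)) \<le> (1 + i * q) ^ r"
proof (induction i arbitrary: r)
  case (Suc i)
  show ?case
  proof (cases r)
    case 0
    \<comment> \<open>With \<open>r = 0\<close> nothing may be added any more, and the level above
      \<open>Suc t\<close> is empty.\<close>
    have "level V (Suc i) (Suc t) = level V i (Suc t)" using level_empty by auto
    with Suc.IH[of 0] 0 show ?thesis by simp
  next
    case (Suc p)
    let ?L = "level V i (Suc (Suc t - r))"
    have L: "card ?L \<le> (1 + i * q) ^ p"
    proof -
      have "Suc (Suc t - r) = Suc t - p" using Suc.prems Suc by arith
      then show ?thesis using Suc.IH[of p] Suc.prems Suc by simp
    qed
    have "card {x. x < q ^ d \<and> translate (V i) c x \<in> ?L} \<le> card ?L" if "c < q" for c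
    proof (rule card_inj_on_le)
      show "inj_on (translate (V i) c) {x. x < q ^ d \<and> translate (V i) c x \<in> ?L}"
        by (rule inj_on_subset[OF inj_on_translate[OF that]]) auto
    qed (auto intro: finite_level)
    then have "card (\<Union>c<q. {x. x < q ^ d \<and> translate (V i) c x \<in> ?L}) \<le> (\<Sum>c<q. card ?L)"
      by (intro order_trans[OF card_UN_le] sum_mono) auto
    also have "(\<Union>c<q. {x. x < q ^ d \<and> translate (V i) c x \<in> ?L}) =
        {x. x < q ^ d \<and> (\<exists>c<q. translate (V i) c x \<in> ?L)}" by auto
    also have "(\<Sum>c<q. card ?L) \<le> q * (1 + i * q) ^ p" using L by simp
    finally have U: "card {x. x < q ^ d \<and> (\<exists>c<q. translate (V i) c x \<in> ?L)} \<le> q * (1 + i * q) ^ p" .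
    have "card (level V (Suc i) (Suc t - r)) \<le>
        card (level V i (Suc t - r)) + card {x. x < q ^ d \<and> (\<exists>c<q. translate (V i) c x \<in> ?L)}"
      by (simp only: level.simps card_Un_le)
    also have "\<dots> \<le> (1 + i * q) ^ r + q * (1 + i * q) ^ p"
      using Suc.IH[OF Suc.prems] U by (rule add_mono)
    also have "\<dots> = (1 + Suc i * q) * (1 + i * q) ^ p" using Suc by (simp add: algebra_simps)
    also have "\<dots> \<le> (1 + Suc i * q) * (1 + Suc i * q) ^ p"
      by (intro mult_le_mono2 power_mono) auto
    finally show ?thesis using Suc by simp
  qed
qed simp

lemma level_subset: "level V i a \<subseteq> {..<q ^ d}"
  by (induction i arbitrary: a) (auto simp: zero_code_less)

text \<open>Level 1 is the case \<open>r = t\<close> of the count. Strictness comes from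
  \<open>1 < q\<close>, which gives \<open>1 + i * q < Suc i * q\<close> \<le>
  \<open>n * q\<close>.\<close>

lemma exists_free:
  assumes "1 \<le> t" "i < n" "(n * q) ^ (2 * t - 1) \<le> q ^ d"
  shows "\<exists>x<q ^ d. x \<notin> level V i 1"
proof -
  have "1 + i * q < Suc i * q" using q_gt_1 by simp
  also have "\<dots> \<le> n * q" using assms(2) by (intro mult_le_mono1) simp
  finally have "(1 + i * q) ^ t < (n * q) ^ t"
    using assms(1) by (intro power_strict_mono) auto
  also have "\<dots> \<le> (n * q) ^ (2 * t - 1)"
    using assms(1,2) q_gt_1 by (intro power_increasing) auto
  finally have "card (level V i 1) < q ^ d"
    using card_level[of t V i] assms(3) by simp
  then have "level V i 1 \<noteq> {..<q ^ d}" by (metis card_lessThan less_irrefl)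
  then show ?thesis using level_subset by blast
qed

text \<open>The term with the largest index is moved from the combination into \<open>x\<close>,
  which becomes a translate of \<open>x\<close>; the remaining combination is shorter by one and
  lives below \<open>i\<close>. Hence \<open>x\<close> and \<open>r\<close> are generalised in the
  induction.\<close>

lemma dependent_in_level:
  assumes "K \<subseteq> {..<i}" "card K \<le> r" "r \<le> t" "x < q ^ d" "a \<in> K \<rightarrow> carrier F"
    and "\<And>j. j < d \<Longrightarrow> digit q x j \<oplus> (\<Oplus>k\<in>K. a k \<otimes> digit q (V k) j) = \<zero>"
  shows "x \<in> level V i (Suc t - r)"
  using assms
proof (induction i arbitrary: K r x)
  case 0
  then have "K = {}" by simp
  with 0 have "digit q x j = \<zero>" if "j < d" for j
    using that by simp
  with 0 have "x = zero_code"
    by (intro digits_eq_imp_eq[of x q d]) (simp_all add: zero_code_less digit_zero_code)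
  with 0 show ?case by simp
next
  case (Suc i)
  show ?case
  proof (cases "i \<in> K")
    case False
    then have "K \<subseteq> {..<i}" using Suc.prems(1) less_Suc_eq by auto
    then have "x \<in> level V i (Suc t - r)" using Suc.prems by (intro Suc.IH) auto
    then show ?thesis by simp
  next
    case True
    let ?K = "K - {i}"
    have fin: "finite K" using Suc.prems(1) finite_subset by blast
    have i: "i \<notin> ?K" "insert i ?K = K" "finite ?K" using True fin by auto
    have cK: "card K = Suc (card ?K)" using True fin by (metis card_Suc_Diff1)
    then obtain p where p: "r = Suc p" using Suc.prems(2) by (cases r) auto
    have a: "a i \<in> carrier F" "a i < q" using Suc.prems(5) True mem_carrier by auto
    have aK: "a k \<in> carrier F" if "k \<in> K" for k using Suc.prems(5) that by auto
    have "translate (V i) (a i) x \<in> level V i (Suc t - p)"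
    proof (rule Suc.IH)
      show "?K \<subseteq> {..<i}" using Suc.prems(1) less_Suc_eq by auto
      show "card ?K \<le> p" "p \<le> t" using cK p Suc.prems(2,3) by auto
      show "translate (V i) (a i) x < q ^ d" using a by (intro translate_less)
      show "a \<in> ?K \<rightarrow> carrier F" using aK by auto
      fix j assume j: "j < d"
      have "(\<Oplus>k\<in>insert i ?K. a k \<otimes> digit q (V k) j) =
          a i \<otimes> digit q (V i) j \<oplus> (\<Oplus>k\<in>?K. a k \<otimes> digit q (V k) j)"
        using aK a i by (intro finsum_insert) auto
      then have "digit q x j \<oplus> (a i \<otimes> digit q (V i) j \<oplus> (\<Oplus>k\<in>?K. a k \<otimes> digit q (V k) j)) = \<zero>"
        using Suc.prems(6)[OF j] unfolding i(2) by simp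
      moreover have "(\<Oplus>k\<in>?K. a k \<otimes> digit q (V k) j) \<in> carrier F"
        using aK by (intro finsum_closed) auto
      ultimately show "digit q (translate (V i) (a i) x) j \<oplus> (\<Oplus>k\<in>?K. a k \<otimes> digit q (V k) j) = \<zero>"
        unfolding digit_translate[OF a(2) j]
        using a_assoc[OF digit_closed m_closed[OF a(1) digit_closed]] by simp
    qed
    moreover have "Suc t - p = Suc (Suc t - r)" using p Suc.prems(3) by arith
    ultimately show ?thesis using a Suc.prems(4) by auto
  qed
qed

end

section \<open>From free choices to linear independence\<close>

locale free_sequence = coded_field +
  fixes V :: "nat \<Rightarrow> nat" and n :: nat
  assumes t: "1 \<le> t"
    and V_less: "\<And>k. k < n \<Longrightarrow> V k < q ^ d"
    and free: "\<And>k. k < n \<Longrightarrow> V k \<notin> level V k 1"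
begin

lemma no_dependency:
  assumes "K \<subseteq> {..<n}" "K \<noteq> {}" "card K \<le> Suc t" "a \<in> K \<rightarrow> carrier F - {\<zero>}"
  shows "\<exists>j<d. (\<Oplus>k\<in>K. a k \<otimes> digit q (V k) j) \<noteq> \<zero>"
proof (rule ccontr)
  assume "\<not> ?thesis"
  then have zero: "(\<Oplus>k\<in>K. a k \<otimes> digit q (V k) j) = \<zero>" if "j < d" for j
    using that by blast
  define m where "m = Max K"
  \<comment> \<open>Normalising the coefficient of the last vector to one puts the relation into the
    form \<open>V m\<close> plus a combination equals zero, as \<open>dependent_in_level\<close>
    expects.\<close>
  define b where "b k = inv (a m) \<otimes> a k" for k
  have fin: "finite K" using assms(1) finite_subset by blast
  have m: "m \<in> K" using fin assms(2) m_def by simp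
  let ?K = "K - {m}"
  have K: "?K \<subseteq> {..<m}" using fin m_def by (auto simp: order_less_le)
  have a: "a k \<in> carrier F" if "k \<in> K" for k using assms(4) that by auto
  have "a m \<in> Units F" using assms(4) m by (auto simp: field_Units)
  then have U: "inv (a m) \<in> carrier F" "inv (a m) \<otimes> a m = \<one>" by simp_all
  \<comment> \<open>\<open>Suc t - t\<close> is 1, left unevaluated to match the case
    \<open>r = t\<close>.\<close>
  have "V m \<in> level V m (Suc t - t)"
  proof (rule dependent_in_level)
    show "?K \<subseteq> {..<m}" by (fact K)
    show "card ?K \<le> t" using assms(3) fin m by simp
    show "V m < q ^ d" using m assms(1) V_less by auto
    show "b \<in> ?K \<rightarrow> carrier F" using a U by (auto simp: b_def)
    fix j assume j: "j < d"
    have c: "a k \<otimes> digit q (V k) j \<in> carrier F" if "k \<in> K" for k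
      using a that by simp
    have "(\<Oplus>k\<in>?K. b k \<otimes> digit q (V k) j) = (\<Oplus>k\<in>?K. inv (a m) \<otimes> (a k \<otimes> digit q (V k) j))"
      using a U by (intro finsum_cong') (auto simp: b_def m_assoc)
    also have "\<dots> = inv (a m) \<otimes> (\<Oplus>k\<in>?K. a k \<otimes> digit q (V k) j)"
      using fin c U by (intro finsum_rdistr[symmetric]) auto
    finally have "digit q (V m) j \<oplus> (\<Oplus>k\<in>?K. b k \<otimes> digit q (V k) j) =
        inv (a m) \<otimes> (a m \<otimes> digit q (V m) j) \<oplus> inv (a m) \<otimes> (\<Oplus>k\<in>?K. a k \<otimes> digit q (V k) j)"
      using U a[OF m] by (simp add: m_assoc[symmetric])
    also have "\<dots> = inv (a m) \<otimes> (a m \<otimes> digit q (V m) j \<oplus> (\<Oplus>k\<in>?K. a k \<otimes> digit q (V k) j))"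
      using U c m by (intro r_distr[symmetric] finsum_closed) auto
    also have "a m \<otimes> digit q (V m) j \<oplus> (\<Oplus>k\<in>?K. a k \<otimes> digit q (V k) j) =
        (\<Oplus>k\<in>insert m ?K. a k \<otimes> digit q (V k) j)"
      using fin c m by (intro finsum_insert[symmetric]) auto
    also have "insert m ?K = K" using m by auto
    finally show "digit q (V m) j \<oplus> (\<Oplus>k\<in>?K. b k \<otimes> digit q (V k) j) = \<zero>"
      using zero[OF j] U by simp
  qed simp
  then show False using free[of m] m assms(1) by auto
qed

definition W :: "nat \<Rightarrow> nat vec" where
  "W k = vec d (digit q (V k))"

text \<open>Equal vectors at two indices would be dependent with coefficients \<open>\<one>\<close>
  and \<open>\<ominus> \<one>\<close>; two indices are within \<open>Suc t\<close> because
  \<open>t\<close> \<ge> 1.\<close>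

lemma inj_W: "inj_on W {..<n}"
proof (rule inj_onI, rule ccontr)
  fix k l assume kl: "k \<in> {..<n}" "l \<in> {..<n}" "W k = W l" "k \<noteq> l"
  define a where "a = (\<lambda>i. if i = k then \<one> else \<ominus> \<one>)"
  have "\<exists>j<d. (\<Oplus>i\<in>{k, l}. a i \<otimes> digit q (V i) j) \<noteq> \<zero>"
    using kl t by (intro no_dependency) (auto simp: a_def)
  moreover have "(\<Oplus>i\<in>{k, l}. a i \<otimes> digit q (V i) j) = \<zero>" if "j < d" for j
  proof -
    have "digit q (V k) j = digit q (V l) j"
      using arg_cong[OF kl(3), of "\<lambda>w. w $ j"] that by (simp add: W_def)
    moreover have "(\<Oplus>i\<in>{k, l}. a i \<otimes> digit q (V i) j) = \<one> \<otimes> digit q (V k) j \<oplus> (\<ominus> \<one>) \<otimes> digit q (V l) j"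
      using kl(4) by (subst finsum_insert) (auto simp: a_def)
    ultimately show ?thesis by (simp add: l_minus r_neg)
  qed
  ultimately show False by blast
qed

text \<open>Reading one coordinate commutes with the sum of the module, which reduces dependence in
  \<open>coord_space\<close> to the scalar equations of \<open>no_dependency\<close>.\<close>

lemma lincomb_index:
  assumes "finite A" "A \<subseteq> carrier (coord_space F d)" "a \<in> A \<rightarrow> carrier F" "j < d"
  shows "module.lincomb (coord_space F d) a A $ j = (\<Oplus>v\<in>A. a v \<otimes> v $ j)"
proof -
  interpret S: vectorspace F "coord_space F d"
    by (rule vectorspace_coord_space) (rule field_axioms)
  show ?thesis
    using assms(1-3)
  proof (induction A)
    case empty
    then show ?case using assms(4) by (simp add: S.lincomb_def) (simp add: coord_space_def)
  next
    case (insert v A)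
    have v: "u $ j \<in> carrier F" if "u \<in> insert v A" for u
      using insert.prems(1) that assms(4) by (auto simp: coord_space_def)
    have "module.lincomb (coord_space F d) a (insert v A) =
        a v \<odot>\<^bsub>coord_space F d\<^esub> v \<oplus>\<^bsub>coord_space F d\<^esub> module.lincomb (coord_space F d) a A"
      unfolding S.lincomb_def using insert by (intro S.finsum_insert) auto
    then have "module.lincomb (coord_space F d) a (insert v A) $ j =
        a v \<otimes> v $ j \<oplus> module.lincomb (coord_space F d) a A $ j"
      using assms(4) by (simp add: coord_space_def)
    also have "\<dots> = a v \<otimes> v $ j \<oplus> (\<Oplus>v\<in>A. a v \<otimes> v $ j)"
      using insert by simp
    also have "\<dots> = (\<Oplus>v\<in>insert v A. a v \<otimes> v $ j)"
      using insert v by (intro finsum_insert[symmetric]) auto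
    finally show ?case .
  qed
qed

lemma W_carrier: "W k \<in> carrier (coord_space F d)"
  by (simp add: W_def coord_space_def)

lemma term_lin_indpt_W: "term_lin_indpt F d t (W ` {..<n})"
  unfolding term_lin_indpt_def
proof (intro conjI allI impI)
  show "W ` {..<n} \<subseteq> carrier (coord_space F d)" using W_carrier by auto
  fix S' assume S': "S' \<subseteq> W ` {..<n} \<and> finite S' \<and> card S' \<le> t"
  interpret S: vectorspace F "coord_space F d"
    by (rule vectorspace_coord_space) (rule field_axioms)
  show "\<not> module.lin_dep F (coord_space F d) S'"
  proof
    assume "S.lin_dep S'"
    then obtain A a v where A: "finite A" "A \<subseteq> S'" "a \<in> A \<rightarrow> carrier F"
      "S.lincomb a A = \<zero>\<^bsub>coord_space F d\<^esub>" "v \<in> A" "a v \<noteq> \<zero>"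
      unfolding S.lin_dep_def by blast
    \<comment> \<open>\<open>lin_dep\<close> asks for just one nonzero coefficient, whereas
      \<open>no_dependency\<close> wants all of them nonzero, so the support is taken. Injectivity
      of \<open>W\<close> lets it be indexed by numbers.\<close>
    define K where "K = {k. k < n \<and> W k \<in> A \<and> a (W k) \<noteq> \<zero>}"
    have inj: "inj_on W K" by (rule inj_on_subset[OF inj_W]) (auto simp: K_def)
    have WK: "W ` K = {u \<in> A. a u \<noteq> \<zero>}" using A(2) S' by (auto simp: K_def)
    have "card K = card (W ` K)" using inj by (simp add: card_image)
    also have "\<dots> \<le> card S'" using A S' WK by (intro card_mono) auto
    finally have "card K \<le> Suc t" using S' by simp
    moreover have "K \<noteq> {}" using WK A(5,6) by blast
    ultimately obtain j where j: "j < d" "(\<Oplus>k\<in>K. a (W k) \<otimes> digit q (V k) j) \<noteq> \<zero>"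
      using no_dependency[of K "\<lambda>k. a (W k)"] A(3) by (auto simp: K_def)
    have AC: "A \<subseteq> carrier (coord_space F d)" using A(2) S' W_carrier by auto
    then have u: "u $ j \<in> carrier F" if "u \<in> A" for u
      using that j(1) by (auto simp: coord_space_def)
    have "\<zero> = S.lincomb a A $ j" using A(4) j(1) by (simp add: coord_space_def)
    also have "\<dots> = (\<Oplus>u\<in>A. a u \<otimes> u $ j)" using A(1,3) AC j(1) by (intro lincomb_index)
    also have "\<dots> = (\<Oplus>u\<in>W ` K. a u \<otimes> u $ j)"
      using A(1,3) u by (intro add.finprod_mono_neutral_cong_right) (auto simp: WK)
    also have "\<dots> = (\<Oplus>k\<in>K. a (W k) \<otimes> W k $ j)"
      using A(3) u inj WK by (intro finsum_reindex) auto
    also have "\<dots> = (\<Oplus>k\<in>K. a (W k) \<otimes> digit q (V k) j)"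
      using j(1) by (simp add: W_def)
    finally show False using j(2) by simp
  qed
qed

end

section \<open>The greedy algorithm\<close>

text \<open>
  Code of \<open>x + c v\<close> from the digits of \<open>x\<close> (in \<open>X\<close>) and \<open>v\<close> (in \<open>Y\<close>) by Horner's rule, from the top
  digit downwards.
\<close>

definition Shift :: com where
  "Shift = Seq (assign ''y'' (Const 0)) (For ''p'' (var ''d'')
    (Seq (assign ''r'' (var ''c''))
    (Seq (Append ''r'' (Read ''Y'' (Minus (Minus (var ''d'') (Const 1)) (var ''p''))))
    (Seq (assign ''w'' (Read ''X'' (Minus (Minus (var ''d'') (Const 1)) (var ''p''))))
    (Seq (Append ''w'' (Read ''mul'' (var ''r'')))
    (Append ''y'' (Read ''add'' (var ''w''))))))))"

lemma mods_Shift [simp]: "mods Shift = {''y'', ''p'', ''r'', ''w'', ''acc'', ''cnt''}"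
  by (auto simp: Shift_def)

text \<open>
  \<open>U x\<close> is the largest \<open>a\<close> with \<open>x \<in> level V i a\<close>, or 0. The new values go through \<open>U2\<close> because they must
  be computed from the old ones.
\<close>

definition Update :: com where
  "Update = Seq
    (For ''x'' (var ''Q'')
      (Seq (Digits ''x'' ''X'')
      (Seq (assign ''m'' (Read ''U'' (var ''x'')))
      (Seq (For ''c'' (var ''q'')
        (Seq Shift
          (Cond (Minus (Minus (Read ''U'' (var ''y'')) (Const 1)) (var ''m''))
            (assign ''m'' (Minus (Read ''U'' (var ''y'')) (Const 1))) Skip)))
      (Write ''U2'' (var ''x'') (var ''m''))))))
    (For ''x'' (var ''Q'') (Write ''U'' (var ''x'') (Read ''U2'' (var ''x''))))"

lemma mods_Update [simp]: "mods Update = {''x'', ''num'', ''pos'', ''rem'', ''quo'', ''sub'', ''X'',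
    ''m'', ''c'', ''y'', ''p'', ''r'', ''w'', ''acc'', ''cnt'', ''U2'', ''U''}"
  by (auto simp: Update_def)

text \<open>\<open>U x = 0\<close> says that \<open>x\<close> is outside level 1, that is, free. The
  scan covers the whole table and keeps the last hit, so that it fits the counting loop.\<close>

definition Search :: com where
  "Search = For ''x'' (var ''Q'') (Cond (Read ''U'' (var ''x'')) Skip (assign ''v'' (var ''x'')))"

lemma mods_Search [simp]: "mods Search = {''x'', ''v''}"
  by (auto simp: Search_def)

text \<open>The output position \<open>o\<close> persists between steps, so \<open>i * d\<close>
  never has to be computed.\<close>

definition Emit :: com where
  "Emit = For ''p'' (var ''d'') (Seq (Write ''S'' (var ''o'') (Read ''Y'' (var ''p'')))
    (assign ''o'' (Plus (var ''o'') (Const 1))))"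

lemma mods_Emit [simp]: "mods Emit = {''p'', ''S'', ''o''}"
  by (auto simp: Emit_def)

definition Step :: com where
  "Step = Seq Search (Seq (Write ''V'' (var ''i'') (var ''v'')) (Seq (Digits ''v'' ''Y'') (Seq Emit Update)))"

lemma mods_Step [simp]: "mods Step = {''x'', ''v'', ''V'', ''num'', ''pos'', ''rem'', ''quo'', ''sub'', ''Y'',
    ''p'', ''S'', ''o'', ''X'', ''m'', ''c'', ''y'', ''r'', ''w'', ''acc'', ''cnt'', ''U2'', ''U''}"
  by (auto simp: Step_def)

text \<open>
  The zero of the field is the only \<open>a\<close> with \<open>a + a = a\<close>.
\<close>

definition Zero :: com where
  "Zero = Seq
    (For ''a'' (var ''q'') (Seq (assign ''r'' (var ''a'')) (Seq (Append ''r'' (var ''a''))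
      (Cond (Plus (Minus (Read ''add'' (var ''r'')) (var ''a'')) (Minus (var ''a'') (Read ''add'' (var ''r''))))
        Skip (assign ''z'' (var ''a''))))))
    (Seq (assign ''y'' (Const 0)) (Seq (For ''p'' (var ''d'') (Append ''y'' (var ''z'')))
      (Write ''U'' (var ''y'') (Plus (var ''t'') (Const 1)))))"

text \<open>
  The dimension is the least \<open>e\<close> with \<open>(n q)\<^sup>2\<^sup>t\<^sup>-\<^sup>1 \<le> q\<^sup>e\<close>, so no logarithm has to be computed.
\<close>

definition Dim :: com where
  "Dim = Seq (assign ''b'' (var ''n'')) (Seq (Mult ''b'' ''q'') (Seq (assign ''M'' (Const 1))
    (Seq (For ''i'' (Minus (Plus (var ''t'') (var ''t'')) (Const 1)) (Mult ''M'' ''b''))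
    (Seq (assign ''Q'' (Const 1))
    (While (Minus (var ''M'') (var ''Q''))
      (Seq (Mult ''Q'' ''q'') (assign ''d'' (Plus (var ''d'') (Const 1)))))))))"

lemma mods_Dim [simp]: "mods Dim = {''b'', ''acc'', ''cnt'', ''M'', ''i'', ''Q'', ''d''}"
  by (auto simp: Dim_def)

definition Construct :: com where
  "Construct = Seq Dim (Seq Zero (For ''i'' (var ''n'') Step))"

section \<open>Correctness and running time of the greedy program\<close>

lemma power_bounds:
  assumes "1 \<le> (K :: nat)"
  shows "1 \<le> K" "K \<le> K ^ 2" "K ^ 2 \<le> K ^ 3" "K ^ 3 \<le> K ^ 4" "K ^ 4 \<le> K ^ 5"
  using power_increasing[of 1 2 K] power_increasing[of 2 3 K] power_increasing[of 3 4 K]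
    power_increasing[of 4 5 K] assms by simp_all

text \<open>The equivalence says that \<open>d\<close> is the least exponent reaching
  \<open>(n * q) ^ (2 * t - 1)\<close>, which is how the program finds it. The numbers
  \<open>q\<close>, \<open>n\<close>, \<open>n * q\<close>, \<open>d\<close>,
  \<open>2 * t - 1\<close> and \<open>q ^ d\<close> that bound the loops all turn out to be below
  \<open>K\<close>.\<close>

locale greedy = coded_field +
  fixes n K :: nat
  assumes t: "1 \<le> t" and n: "1 \<le> n"
    and d: "\<And>e. (n * q) ^ (2 * t - 1) \<le> q ^ e \<longleftrightarrow> d \<le> e"
    and K: "q ^ d < K"
begin

lemma nq_le: "n * q \<le> (n * q) ^ (2 * t - 1)"
  using power_increasing[of 1 "2 * t - 1" "n * q"] t n q_gt_1 by simp

lemma nq_less: "n * q < K"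
  using nq_le d[of d] K by simp

lemma q_less: "q < K"
proof -
  have "q \<le> n * q" using n by simp
  then show ?thesis using nq_less by linarith
qed

lemma n_less: "n < K"
proof -
  have "n \<le> n * q" using q_gt_1 by simp
  then show ?thesis using nq_less by linarith
qed

lemma d_less: "d < K"
proof -
  have "d < 2 ^ d" by (rule less_exp)
  also have "\<dots> \<le> q ^ d" using q_gt_1 by (intro power_mono) auto
  finally show ?thesis using K by simp
qed

lemma t_less: "2 * t - 1 < K"
proof -
  have "2 * 1 \<le> q * n" using q_gt_1 n by (intro mult_le_mono) auto
  then have "2 \<le> n * q" by (simp add: mult.commute)
  have "2 * t - 1 < 2 ^ (2 * t - 1)" by (rule less_exp)
  also have "\<dots> \<le> (n * q) ^ (2 * t - 1)" using \<open>2 \<le> n * q\<close> by (intro power_mono) auto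
  finally show ?thesis using d[of d] K by simp
qed

text \<open>For \<open>linarith\<close> the powers of \<open>K\<close> are atoms; this chain lets it
  absorb the lower-order terms of the time bounds.\<close>

lemma K_bounds: "1 \<le> K" "K \<le> K ^ 2" "K ^ 2 \<le> K ^ 3" "K ^ 3 \<le> K ^ 4" "K ^ 4 \<le> K ^ 5"
  using power_bounds q_less by simp_all

text \<open>The part of the state that stays fixed once \<open>Dim\<close> has run;
  \<open>ready_agree\<close> carries it past any command that spares these arrays.\<close>

definition ready :: "state \<Rightarrow> bool" where
  "ready s \<longleftrightarrow> s ''q'' 0 = q \<and> s ''d'' 0 = d \<and> s ''n'' 0 = n \<and> s ''Q'' 0 = q ^ d \<and>
    (\<forall>a<q. \<forall>b<q. s ''add'' (a * q + b) = a \<oplus> b \<and> s ''mul'' (a * q + b) = a \<otimes> b)"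

lemma ready_agree:
  assumes "agree X s s'" "X \<inter> {''q'', ''d'', ''n'', ''Q'', ''add'', ''mul''} = {}"
  shows "ready s' \<longleftrightarrow> ready s"
proof -
  have "s' x = s x" if "x \<in> {''q'', ''d'', ''n'', ''Q'', ''add'', ''mul''}" for x
    using assms that unfolding agree_def by blast
  then show ?thesis by (simp add: ready_def)
qed

lemma ready_store [simp]:
  "x \<notin> {''q'', ''d'', ''n'', ''Q'', ''add'', ''mul''} \<Longrightarrow> ready (store x i a s) \<longleftrightarrow> ready s"
  by (rule ready_agree[of "{x}"]) (auto simp: agree_def)

lemma run_Shift:
  assumes "ready s" "\<And>j. j < d \<Longrightarrow> s ''X'' j = digit q x j" "\<And>j. j < d \<Longrightarrow> s ''Y'' j = digit q v j"
    and c: "s ''c'' 0 = c" "c < q"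
  shows "run Shift s (200 * K ^ 2) (\<lambda>s'. s' ''y'' 0 = translate v c x)"
proof -
  let ?ix = "Minus (Minus (var ''d'') (Const 1)) (var ''p'')"
  let ?c3 = "Seq (Append ''w'' (Read ''mul'' (var ''r''))) (Append ''y'' (Read ''add'' (var ''w'')))"
  let ?c1 = "Seq (Append ''r'' (Read ''Y'' ?ix)) (Seq (assign ''w'' (Read ''X'' ?ix)) ?c3)"
  let ?s = "store ''y'' 0 0 s"
  let ?f = "\<lambda>j. digit q x j \<oplus> c \<otimes> digit q v j"
  \<comment> \<open>After \<open>i\<close> rounds \<open>y\<close> codes the top \<open>i\<close>
    digits, those from position \<open>d - i\<close> on; the next round adds digit
    \<open>d - Suc i\<close> as the least significant one.\<close>
  let ?I = "\<lambda>i s'. s' ''y'' 0 = undigits q (\<lambda>k. ?f (k + (d - i))) i"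
  have loop: "run (For ''p'' (var ''d'') (Seq (assign ''r'' (var ''c'')) ?c1)) ?s
      (K * (190 * K)) (\<lambda>s'. s' ''y'' 0 = translate v c x)"
  proof (rule run_For[where I = ?I])
    fix i s' assume i: "i < d"
      and ag: "agree (insert ''p'' (mods (Seq (assign ''r'' (var ''c'')) ?c1))) ?s s'"
      and p: "s' ''p'' 0 = i" and I: "?I i s'"
    define j where "j = d - Suc i"
    have j: "j < d" using i by (simp add: j_def)
    have eq: "s' ''X'' = s ''X''" "s' ''Y'' = s ''Y''" "s' ''c'' = s ''c''" "ready s'"
      using ag assms(1) ready_agree[OF ag] by (simp_all add: agree_def)
    have q: "s' ''q'' 0 = q" "s' ''d'' 0 = d" using eq(4) by (simp_all add: ready_def)
    have dv: "digit q v j < q" and dx: "digit q x j < q" and cd: "c \<otimes> digit q v j < q"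
      using c(2) by (auto simp: mem_carrier[symmetric])
    have step: "undigits q (\<lambda>k. ?f (k + (d - Suc i))) (Suc i) =
        undigits q (\<lambda>k. ?f (k + (d - i))) i * q + (digit q x j \<oplus> c \<otimes> digit q v j)"
    proof -
      have "Suc k + (d - Suc i) = k + (d - i)" for k using i by simp
      then show ?thesis by (simp add: j_def)
    qed
    show "run (Seq (assign ''r'' (var ''c'')) ?c1) s' (170 * K) (?I (Suc i))"
    proof (rule run_le, rule run_Write_then,
        rule run_Seq[OF run_Append[where a = c and b = "digit q v j" and q = q and K = K]])
      fix s2
      assume ag2: "agree (mods (Append ''r'' (Read ''Y'' ?ix))) (store ''r'' 0 c s') s2"
        and r: "s2 ''r'' 0 = c * q + digit q v j"
      have eq2: "s2 ''X'' = s ''X''" "s2 ''y'' = s' ''y''" "s2 ''p'' 0 = i" "s2 ''d'' 0 = d" "ready s2"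
        using ag2 eq p q ready_agree[OF ag2] by (simp_all add: agree_def)
      show "run (Seq (assign ''w'' (Read ''X'' ?ix)) ?c3) s2
        (1 + cost_exp (Const 0) + cost_exp (Read ''X'' ?ix) + (50 * K + 50 * K)) (?I (Suc i))"
      proof (rule run_Write_then,
          rule run_Seq[OF run_Append[where a = "digit q x j" and b = "c \<otimes> digit q v j" and q = q and K = K]])
        let ?s2 = "store ''w'' 0 (digit q x j) s2"
        show "eval_exp (Read ''mul'' (var ''r'')) s3 = c \<otimes> digit q v j"
          if "agree {''acc'', ''cnt'', ''w''} ?s2 s3" for s3
          using that r eq2(5) c(2) dv by (simp add: agree_def ready_def)
        fix s3
        assume ag3: "agree (mods (Append ''w'' (Read ''mul'' (var ''r'')))) ?s2 s3"
          and w: "s3 ''w'' 0 = digit q x j * q + c \<otimes> digit q v j"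
        have eq3: "s3 ''y'' = s' ''y''" "ready s3"
          using ag3 eq2 ready_agree[OF ag3] by (simp_all add: agree_def)
        have "run (Append ''y'' (Read ''add'' (var ''w''))) s3 (50 * K)
            (\<lambda>s'. s' ''y'' 0 = undigits q (\<lambda>k. ?f (k + (d - i))) i * q + (digit q x j \<oplus> c \<otimes> digit q v j))"
        proof (rule run_Append)
          show "eval_exp (Read ''add'' (var ''w'')) s4 = digit q x j \<oplus> c \<otimes> digit q v j"
            if "agree {''acc'', ''cnt'', ''y''} s3 s4" for s4
            using that w eq3(2) dx cd by (simp add: agree_def ready_def)
        qed (use eq3 I q_less in \<open>auto simp: ready_def\<close>)
        then show "run (Append ''y'' (Read ''add'' (var ''w''))) s3 (50 * K) (?I (Suc i))"
          unfolding step .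
      qed (use eq2 assms(2) j q_less in \<open>auto simp: ready_def j_def\<close>)
    next
      show "eval_exp (Read ''Y'' ?ix) s2 = digit q v j"
        if "agree {''acc'', ''cnt'', ''r''} (store ''r'' 0 c s') s2" for s2
        using that eq(2) p q assms(3) j by (simp add: agree_def j_def)
      show "1 + cost_exp (Const 0) + cost_exp (var ''c'') + (50 * K + (1 + cost_exp (Const 0) +
          cost_exp (Read ''X'' ?ix) + (50 * K + 50 * K))) \<le> 170 * K"
        using K_bounds(1) by simp
    qed (use eq q c q_less in auto)
  next
    fix s' assume "agree (insert ''p'' (mods (Seq (assign ''r'' (var ''c'')) ?c1))) ?s s'"
    then show "eval_exp (var ''d'') s' = d"
      using assms(1) by (simp add: agree_def ready_def)
  qed (use d_less K_bounds(1) in \<open>auto simp: translate_def\<close>)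
  have "K * (190 * K) = 190 * K ^ 2"
    by (simp add: power2_eq_square)
  then have time: "1 + cost_exp (Const 0) + cost_exp (Const 0) + K * (190 * K) \<le> 200 * K ^ 2"
    using K_bounds unfolding cost_exp.simps by linarith
  show ?thesis
    unfolding Shift_def by (rule run_le, rule run_Write_then, rule loop) (simp, simp, rule time)
qed

text \<open>Thresholds are used instead of a maximum because \<open>a\<close> \<le>
  \<open>max\<close> splits into a disjunction. Reading \<open>a\<close> \<le> \<open>U x\<close> as
  membership in level \<open>a\<close>, the postcondition becomes the recursive clause of
  \<open>level\<close>.\<close>

lemma run_Update:
  assumes ready: "ready s" and Y: "\<And>j. j < d \<Longrightarrow> s ''Y'' j = digit q v j"
  shows "run Update s (500 * K ^ 4) (\<lambda>s'. \<forall>x<q ^ d. \<forall>a\<ge>1.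
    a \<le> s' ''U'' x \<longleftrightarrow> a \<le> s ''U'' x \<or> (\<exists>c<q. Suc a \<le> s ''U'' (translate v c x)))"
proof -
  define P where "P x m k \<longleftrightarrow> (\<forall>a\<ge>1. a \<le> m \<longleftrightarrow> a \<le> s ''U'' x \<or>
    (\<exists>c<k. Suc a \<le> s ''U'' (translate v c x)))" for x m k
  let ?upd = "Cond (Minus (Minus (Read ''U'' (var ''y'')) (Const 1)) (var ''m''))
            (assign ''m'' (Minus (Read ''U'' (var ''y'')) (Const 1))) Skip"
  let ?c3 = "Seq (For ''c'' (var ''q'') (Seq Shift ?upd)) (Write ''U2'' (var ''x'') (var ''m''))"
  let ?c = "Seq (Digits ''x'' ''X'') (Seq (assign ''m'' (Read ''U'' (var ''x''))) ?c3)"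
  have inner: "run (For ''c'' (var ''q'') (Seq Shift ?upd)) s1 (K * (250 * K ^ 2)) (\<lambda>s'. P x (s' ''m'' 0) q)"
    if "ready s1" "\<And>j. j < d \<Longrightarrow> s1 ''X'' j = digit q x j" "s1 ''Y'' = s ''Y''" "s1 ''U'' = s ''U''"
      "s1 ''m'' 0 = s ''U'' x" for s1 x
  proof (rule run_For[where I = "\<lambda>i s'. P x (s' ''m'' 0) i"])
    fix i s' assume i: "i < q" and ag: "agree (insert ''c'' (mods (Seq Shift ?upd))) s1 s'"
      and c: "s' ''c'' 0 = i" and I: "P x (s' ''m'' 0) i"
    have eq: "ready s'" "s' ''X'' = s1 ''X''" "s' ''Y'' = s1 ''Y''" "s' ''U'' = s1 ''U''"
      using ag that(1) ready_agree[OF ag] by (simp_all add: agree_def)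
    let ?u = "s ''U'' (translate v i x)"
    have "run Shift s' (200 * K ^ 2) (\<lambda>s'. s' ''y'' 0 = translate v i x)"
      using eq that Y c i by (intro run_Shift) auto
    then show "run (Seq Shift ?upd) s' (200 * K ^ 2 + 30) (\<lambda>s'. P x (s' ''m'' 0) (Suc i))"
    proof (rule run_Seq)
      fix s2 assume ag2: "agree (mods Shift) s' s2" and y: "s2 ''y'' 0 = translate v i x"
      have eq2: "s2 ''U'' = s ''U''" "s2 ''m'' = s' ''m''"
        using ag2 eq(4) that(4) by (simp_all add: agree_def)
      \<comment> \<open>For \<open>a\<close> \<ge> 1 the condition \<open>a\<close> \<le>
        \<open>?u - 1\<close> amounts to \<open>Suc a\<close> \<le> \<open>?u\<close> in spite of
        truncated subtraction.\<close>
      have P: "P x (max (s2 ''m'' 0) (?u - 1)) (Suc i)"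
        using I unfolding P_def eq2(2) by (auto simp: less_Suc_eq le_max_iff_disj)
      have "run ?upd s2 (1 + cost_exp (Minus (Minus (Read ''U'' (var ''y'')) (Const 1)) (var ''m'')) +
          (1 + cost_exp (Const 0) + cost_exp (Minus (Read ''U'' (var ''y'')) (Const 1))) + 1)
          (\<lambda>s'. s' ''m'' 0 = max (s2 ''m'' 0) (?u - 1))"
        using y eq2(1) by (intro run_Cond run_Write run_Skip) auto
      then show "run ?upd s2 30 (\<lambda>s'. P x (s' ''m'' 0) (Suc i))"
        by (rule run_conseq) (use P in auto)
    qed
  next
    fix s' assume "agree (insert ''c'' (mods (Seq Shift ?upd))) s1 s'"
    then show "eval_exp (var ''q'') s' = q" using that(1) by (simp add: agree_def ready_def)
  next
    show "P x (s1 ''m'' 0) 0" using that(5) by (simp add: P_def)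
    show "200 * K ^ 2 + 30 + cost_exp (var ''q'') + 10 \<le> 250 * K ^ 2"
      using K_bounds unfolding cost_exp.simps by linarith
  qed (use q_less in auto)
  have K1: "K * K = K ^ 2" "K * (250 * K ^ 2) = 250 * K ^ 3" "K * (400 * K ^ 3) = 400 * K ^ 4"
    by (simp_all add: power2_eq_square power3_eq_cube power4_eq_xxxx)
  let ?I = "\<lambda>i s'. \<forall>x<i. P x (s' ''U2'' x) q"
  have first: "run (For ''x'' (var ''Q'') ?c) s (K * (400 * K ^ 3)) (?I (q ^ d))"
  proof (rule run_For[where I = ?I])
    fix x s' assume x: "x < q ^ d" and ag: "agree (insert ''x'' (mods ?c)) s s'"
      and i: "s' ''x'' 0 = x" and I: "?I x s'"
    have eq: "ready s'" "s' ''Y'' = s ''Y''" "s' ''U'' = s ''U''"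
      using ag ready ready_agree[OF ag] by (simp_all add: agree_def)
    have "run (Digits ''x'' ''X'') s' (100 * (K * K)) (\<lambda>s'. \<forall>j<d. s' ''X'' j = digit q x j)"
      using eq(1) i x K d_less q_gt_1 by (intro run_Digits) (auto simp: ready_def)
    then show "run ?c s' (100 * (K * K) + (1 + cost_exp (Const 0) + cost_exp (Read ''U'' (var ''x'')) +
        (K * (250 * K ^ 2) + (1 + cost_exp (var ''x'') + cost_exp (var ''m''))))) (?I (Suc x))"
    proof (rule run_Seq)
      fix s2 assume ag2: "agree (mods (Digits ''x'' ''X'')) s' s2" and X: "\<forall>j<d. s2 ''X'' j = digit q x j"
      have eq2: "ready s2" "s2 ''Y'' = s ''Y''" "s2 ''U'' = s ''U''" "s2 ''U2'' = s' ''U2''" "s2 ''x'' 0 = x"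
        using ag2 eq i ready_agree[OF ag2] by (simp_all add: agree_def)
      let ?s2 = "store ''m'' 0 (s ''U'' x) s2"
      have body: "run ?c3 ?s2 (K * (250 * K ^ 2) + (1 + cost_exp (var ''x'') + cost_exp (var ''m''))) (?I (Suc x))"
      proof (rule run_Seq[OF inner])
        fix s3 assume ag3: "agree (mods (For ''c'' (var ''q'') (Seq Shift ?upd))) ?s2 s3"
          and P: "P x (s3 ''m'' 0) q"
        have "s3 ''x'' 0 = x" "s3 ''U2'' = s' ''U2''"
          using ag3 eq2 by (simp_all add: agree_def)
        then show "run (Write ''U2'' (var ''x'') (var ''m'')) s3 (1 + cost_exp (var ''x'') + cost_exp (var ''m'')) (?I (Suc x))"
          using P I by (intro run_Write) (auto simp: less_Suc_eq)
      qed (use eq2 X in auto)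
      show "run (Seq (assign ''m'' (Read ''U'' (var ''x''))) ?c3) s2
          (1 + cost_exp (Const 0) + cost_exp (Read ''U'' (var ''x'')) +
            (K * (250 * K ^ 2) + (1 + cost_exp (var ''x'') + cost_exp (var ''m'')))) (?I (Suc x))"
        by (rule run_Write_then, rule body) (use eq2 in simp_all)
    qed
  next
    fix s' assume "agree (insert ''x'' (mods ?c)) s s'"
    then show "eval_exp (var ''Q'') s' = q ^ d" using ready by (simp add: agree_def ready_def)
  next
    show "100 * (K * K) + (1 + cost_exp (Const 0) + cost_exp (Read ''U'' (var ''x'')) +
        (K * (250 * K ^ 2) + (1 + cost_exp (var ''x'') + cost_exp (var ''m'')))) + cost_exp (var ''Q'') + 10
      \<le> 400 * K ^ 3"
      using K_bounds unfolding cost_exp.simps K1 by linarith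
  qed (use K in auto)
  \<comment> \<open>\<open>P\<close> refers to \<open>U\<close> in the initial state
    \<open>s\<close>, so overwriting \<open>U\<close> entry by entry does not disturb it.\<close>
  let ?J = "\<lambda>i s'. \<forall>x<i. P x (s' ''U'' x) q"
  show ?thesis
    unfolding Update_def
  proof (rule run_le, rule run_Seq[OF first])
    fix s1 assume ag: "agree (mods (For ''x'' (var ''Q'') ?c)) s s1" and I: "?I (q ^ d) s1"
    let ?copy = "Write ''U'' (var ''x'') (Read ''U2'' (var ''x''))"
    show "run (For ''x'' (var ''Q'') ?copy) s1 (K * 30)
      (\<lambda>s'. \<forall>x<q ^ d. \<forall>a\<ge>1. a \<le> s' ''U'' x \<longleftrightarrow> a \<le> s ''U'' x \<or>
        (\<exists>c<q. Suc a \<le> s ''U'' (translate v c x)))"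
    proof (rule run_For[where I = ?J])
      fix x s' assume x: "x < q ^ d" and ag: "agree (insert ''x'' (mods ?copy)) s1 s'"
        and i: "s' ''x'' 0 = x" and J: "?J x s'"
      have "s' ''U2'' = s1 ''U2''" using ag by (simp add: agree_def)
      then show "run ?copy s' (1 + cost_exp (var ''x'') + cost_exp (Read ''U2'' (var ''x''))) (?J (Suc x))"
        using i J I x by (intro run_Write) (auto simp: less_Suc_eq)
    next
      fix s' assume "agree (insert ''x'' (mods ?copy)) s1 s'"
      then show "eval_exp (var ''Q'') s' = q ^ d" using ready ag by (simp add: agree_def ready_def)
    qed (use K in \<open>auto simp: P_def\<close>)
  next
    show "K * (400 * K ^ 3) + K * 30 \<le> 500 * K ^ 4"
      using K_bounds unfolding K1 by linarith
  qed
qed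

end

context greedy
begin

lemma run_Search:
  assumes "ready s" "\<exists>x<q ^ d. s ''U'' x = 0"
  shows "run Search s (K * 50) (\<lambda>s'. s' ''v'' 0 < q ^ d \<and> s ''U'' (s' ''v'' 0) = 0)"
proof -
  let ?c = "Cond (Read ''U'' (var ''x'')) Skip (assign ''v'' (var ''x''))"
  let ?I = "\<lambda>i s'. (\<exists>x<i. s ''U'' x = 0) \<longrightarrow> s' ''v'' 0 < q ^ d \<and> s ''U'' (s' ''v'' 0) = 0"
  show ?thesis
    unfolding Search_def
  proof (rule run_For[where I = ?I])
    fix x s' assume x: "x < q ^ d" and ag: "agree (insert ''x'' (mods ?c)) s s'"
      and i: "s' ''x'' 0 = x" and I: "?I x s'"
    have U: "s' ''U'' = s ''U''" using ag by (simp add: agree_def)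
    show "run ?c s' (1 + cost_exp (Read ''U'' (var ''x'')) + 1 + (1 + cost_exp (Const 0) + cost_exp (var ''x'')))
        (?I (Suc x))"
      using x i I U by (intro run_Cond run_Skip run_Write) (auto simp: less_Suc_eq)
  next
    fix s' assume "agree (insert ''x'' (mods ?c)) s s'"
    then show "eval_exp (var ''Q'') s' = q ^ d" using assms(1) by (simp add: agree_def ready_def)
  qed (use K assms(2) in auto)
qed

lemma run_Emit:
  assumes "ready s" "s ''o'' 0 = a"
  shows "run Emit s (K * 50) (\<lambda>s'. s' ''o'' 0 = a + d \<and>
    (\<forall>j<d. s' ''S'' (a + j) = s ''Y'' j) \<and> (\<forall>k<a. s' ''S'' k = s ''S'' k))"
proof -
  let ?c = "Seq (Write ''S'' (var ''o'') (Read ''Y'' (var ''p''))) (assign ''o'' (Plus (var ''o'') (Const 1)))"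
  let ?I = "\<lambda>i s'. s' ''o'' 0 = a + i \<and>
    (\<forall>j<i. s' ''S'' (a + j) = s ''Y'' j) \<and> (\<forall>k<a. s' ''S'' k = s ''S'' k)"
  show ?thesis
    unfolding Emit_def
  proof (rule run_For[where I = ?I])
    fix i s' assume ag: "agree (insert ''p'' (mods ?c)) s s'"
      and i: "s' ''p'' 0 = i" and I: "?I i s'"
    have "s' ''Y'' = s ''Y''" using ag by (simp add: agree_def)
    then show "run ?c s' (1 + cost_exp (var ''o'') + cost_exp (Read ''Y'' (var ''p'')) +
        (1 + cost_exp (Const 0) + cost_exp (Plus (var ''o'') (Const 1)))) (?I (Suc i))"
      using i I by (intro run_Seq_Write run_Write) (auto simp: less_Suc_eq)
  next
    fix s' assume "agree (insert ''p'' (mods ?c)) s s'"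
    then show "eval_exp (var ''d'') s' = d" using assms(1) by (simp add: agree_def ready_def)
  qed (use d_less assms(2) in auto)
qed

text \<open>The array \<open>V\<close> is a ghost: the program writes it but never reads it, and it
  hands the sequence of choices to \<open>level\<close> as a function.\<close>

definition greedy_inv :: "nat \<Rightarrow> state \<Rightarrow> bool" where
  "greedy_inv i s \<longleftrightarrow> ready s \<and> s ''o'' 0 = i * d \<and>
    (\<forall>k<i. s ''V'' k < q ^ d \<and> s ''V'' k \<notin> level (s ''V'') k 1) \<and>
    (\<forall>x<q ^ d. \<forall>a\<ge>1. a \<le> s ''U'' x \<longleftrightarrow> x \<in> level (s ''V'') i a) \<and>
    (\<forall>k<i. \<forall>j<d. s ''S'' (k * d + j) = digit q (s ''V'' k) j)"

text \<open>By \<open>level_cong\<close>, writing position \<open>i\<close> of \<open>V\<close>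
  changes no level built from the first \<open>i\<close> vectors, so facts about the old array carry
  over to the new one.\<close>

lemma greedy_inv_Suc:
  assumes inv: "greedy_inv i s"
    and v: "v < q ^ d" "s ''U'' v = 0"
    and ready: "ready s'" and V: "s' ''V'' = (s ''V'')(i := v)" and o: "s' ''o'' 0 = i * d + d"
    and S: "\<And>j. j < d \<Longrightarrow> s' ''S'' (i * d + j) = digit q v j" "\<And>k. k < i * d \<Longrightarrow> s' ''S'' k = s ''S'' k"
    and U: "\<forall>x<q ^ d. \<forall>a\<ge>1. a \<le> s' ''U'' x \<longleftrightarrow> a \<le> s ''U'' x \<or> (\<exists>c<q. Suc a \<le> s ''U'' (translate v c x))"
  shows "greedy_inv (Suc i) s'"
proof -
  have level: "level ((s ''V'')(i := v)) k a = level (s ''V'') k a" if "k \<le> i" for k a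
    using that by (intro level_cong) simp
  have U0: "a \<le> s ''U'' x \<longleftrightarrow> x \<in> level (s ''V'') i a" if "x < q ^ d" "1 \<le> a" for x a
    using inv that by (simp add: greedy_inv_def)
  have "v \<notin> level (s ''V'') i 1" using U0[OF v(1), of 1] v(2) by simp
  then have new: "\<forall>k<Suc i. s' ''V'' k < q ^ d \<and> s' ''V'' k \<notin> level (s' ''V'') k 1"
    using inv v(1) by (auto simp: greedy_inv_def less_Suc_eq level V)
  have "a \<le> s' ''U'' x \<longleftrightarrow> x \<in> level (s' ''V'') (Suc i) a" if "x < q ^ d" "1 \<le> a" for x a
  proof -
    have "Suc a \<le> s ''U'' (translate v c x) \<longleftrightarrow> translate v c x \<in> level (s ''V'') i (Suc a)" if "c < q" for c
      using that by (intro U0 translate_less) auto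
    then have "a \<le> s' ''U'' x \<longleftrightarrow> x \<in> level (s ''V'') i a \<or>
        (\<exists>c<q. translate v c x \<in> level (s ''V'') i (Suc a))"
      using U U0[OF that] that by blast
    then show ?thesis using that(1) by (simp add: level V)
  qed
  moreover have "s' ''S'' (k * d + j) = digit q (s' ''V'' k) j" if "k < Suc i" "j < d" for k j
  proof (cases "k = i")
    case True
    then show ?thesis using S(1)[OF that(2)] by (simp add: V)
  next
    case False
    then have "k < i" using that by simp
    \<comment> \<open>Block \<open>k\<close> of the output ends before block \<open>i\<close>
      begins, so the emission left it untouched.\<close>
    then have "k * d + d \<le> i * d" using mult_le_mono1[of "Suc k" i d] by simp
    then show ?thesis using S(2)[of "k * d + j"] that \<open>k < i\<close> inv by (simp add: greedy_inv_def V)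
  qed
  ultimately show ?thesis
    using new ready o unfolding greedy_inv_def by simp
qed

lemma run_Step:
  assumes i: "i < n" "s ''i'' 0 = i" and inv: "greedy_inv i s"
  shows "run Step s (800 * K ^ 4) (greedy_inv (Suc i))"
proof -
  have ready: "ready s" and o: "s ''o'' 0 = i * d"
    and U: "\<And>x a. x < q ^ d \<Longrightarrow> 1 \<le> a \<Longrightarrow> a \<le> s ''U'' x \<longleftrightarrow> x \<in> level (s ''V'') i a"
    using inv by (auto simp: greedy_inv_def)
  obtain x where "x < q ^ d" "x \<notin> level (s ''V'') i 1"
    using exists_free[OF t i(1)] d[of d] by auto
  then have "\<exists>x<q ^ d. s ''U'' x = 0" using U[of x 1] by auto
  note search = run_Search[OF ready this]
  let ?T = "1 + cost_exp (var ''i'') + cost_exp (var ''v'') + (100 * (K * K) + (K * 50 + 500 * K ^ 4))"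
  show ?thesis
    unfolding Step_def
  proof (rule run_le, rule run_Seq[OF search])
    fix s1 assume ag1: "agree (mods Search) s s1"
      and v: "s1 ''v'' 0 < q ^ d \<and> s ''U'' (s1 ''v'' 0) = 0"
    let ?v = "s1 ''v'' 0"
    let ?s1 = "store ''V'' i ?v s1"
    have eq1: "ready s1" "s1 ''U'' = s ''U''" "s1 ''S'' = s ''S''" "s1 ''V'' = s ''V''"
        "s1 ''i'' 0 = i" "s1 ''o'' 0 = i * d"
      using ag1 ready i o ready_agree[OF ag1] by (simp_all add: agree_def)
    have digits: "run (Digits ''v'' ''Y'') ?s1 (100 * (K * K)) (\<lambda>s'. \<forall>j<d. s' ''Y'' j = digit q ?v j)"
      using eq1(1) v K d_less q_gt_1 by (intro run_Digits) (auto simp: ready_def)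
    have rest: "run (Seq (Digits ''v'' ''Y'') (Seq Emit Update)) ?s1 (100 * (K * K) + (K * 50 + 500 * K ^ 4))
        (greedy_inv (Suc i))"
    proof (rule run_Seq[OF digits])
      fix s2 assume ag2: "agree (mods (Digits ''v'' ''Y'')) ?s1 s2" and Y: "\<forall>j<d. s2 ''Y'' j = digit q ?v j"
      have eq2: "ready s2" "s2 ''U'' = s ''U''" "s2 ''S'' = s ''S''" "s2 ''V'' = (s ''V'')(i := ?v)"
        "s2 ''o'' 0 = i * d"
        using ag2 eq1 ready_agree[OF ag2] by (simp_all add: agree_def)
      show "run (Seq Emit Update) s2 (K * 50 + 500 * K ^ 4) (greedy_inv (Suc i))"
      proof (rule run_Seq[OF run_Emit[OF eq2(1,5)]])
        fix s3 assume ag3: "agree (mods Emit) s2 s3"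
          and emit: "s3 ''o'' 0 = i * d + d \<and> (\<forall>j<d. s3 ''S'' (i * d + j) = s2 ''Y'' j) \<and>
            (\<forall>k<i * d. s3 ''S'' k = s2 ''S'' k)"
        have eq3: "ready s3" "s3 ''U'' = s ''U''" "s3 ''V'' = (s ''V'')(i := ?v)" "s3 ''Y'' = s2 ''Y''"
          using ag3 eq2 ready_agree[OF ag3] by (simp_all add: agree_def)
        have "run Update s3 (500 * K ^ 4) (\<lambda>s'. \<forall>x<q ^ d. \<forall>a\<ge>1. a \<le> s' ''U'' x \<longleftrightarrow>
            a \<le> s3 ''U'' x \<or> (\<exists>c<q. Suc a \<le> s3 ''U'' (translate ?v c x)))"
          using eq3 Y by (intro run_Update) auto
        then show "run Update s3 (500 * K ^ 4) (greedy_inv (Suc i))"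
        proof (rule run_conseq)
          fix s4 assume ag4: "agree (mods Update) s3 s4"
            and U4: "\<forall>x<q ^ d. \<forall>a\<ge>1. a \<le> s4 ''U'' x \<longleftrightarrow>
              a \<le> s3 ''U'' x \<or> (\<exists>c<q. Suc a \<le> s3 ''U'' (translate ?v c x))"
          have eq4: "ready s4" "s4 ''V'' = (s ''V'')(i := ?v)" "s4 ''o'' = s3 ''o''" "s4 ''S'' = s3 ''S''"
            using ag4 eq3 ready_agree[OF ag4] by (simp_all add: agree_def)
          show "greedy_inv (Suc i) s4"
            using U4 unfolding eq3(2)
            by (intro greedy_inv_Suc[OF inv _ _ eq4(1,2)]) (use v eq4 emit eq2(3) Y in auto)
        qed simp
      qed
    qed
    show "run (Seq (Write ''V'' (var ''i'') (var ''v'')) (Seq (Digits ''v'' ''Y'') (Seq Emit Update))) s1 ?T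
        (greedy_inv (Suc i))"
      by (rule run_Write_then, rule rest) (use eq1 in simp_all)
  next
    have "K * K = K ^ 2" by (simp add: power2_eq_square)
    then show "K * 50 + ?T \<le> 800 * K ^ 4"
      using K_bounds unfolding cost_exp.simps by linarith
  qed
qed

lemma double_eq_self: "a \<in> carrier F \<Longrightarrow> a \<oplus> a = a \<longleftrightarrow> a = \<zero>"
  using add.l_cancel_one by force

text \<open>Before any choice only the zero vector needs nothing added, and it belongs to all levels
  up to \<open>t + 1\<close>; hence the single entry \<open>t + 1\<close> in an otherwise zero
  table.\<close>

lemma run_Zero:
  assumes ready: "ready s" and "s ''t'' 0 = t" "s ''U'' = (\<lambda>_. 0)" "s ''o'' 0 = 0"
  shows "run Zero s (500 * K ^ 2) (greedy_inv 0)"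
proof -
  let ?test = "Cond (Plus (Minus (Read ''add'' (var ''r'')) (var ''a'')) (Minus (var ''a'') (Read ''add'' (var ''r''))))
        Skip (assign ''z'' (var ''a''))"
  let ?c = "Seq (assign ''r'' (var ''a'')) (Seq (Append ''r'' (var ''a'')) ?test)"
  let ?I = "\<lambda>i s'. \<zero> < i \<longrightarrow> s' ''z'' 0 = \<zero>"
  let ?end = "Write ''U'' (var ''y'') (Plus (var ''t'') (Const 1))"
  let ?enc = "For ''p'' (var ''d'') (Append ''y'' (var ''z''))"
  have find: "run (For ''a'' (var ''q'') ?c) s (K * (100 * K)) (\<lambda>s'. s' ''z'' 0 = \<zero>)"
  proof (rule run_For[where I = ?I])
    fix a s' assume a: "a < q" and ag: "agree (insert ''a'' (mods ?c)) s s'"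
      and i: "s' ''a'' 0 = a" and I: "?I a s'"
    have r: "ready s'" using ag ready ready_agree[OF ag] by simp
    show "run ?c s' (1 + cost_exp (Const 0) + cost_exp (var ''a'') + (50 * K + 30)) (?I (Suc a))"
    proof (rule run_Write_then, rule run_Seq[OF run_Append[where a = a and b = a and q = q and K = K]])
      fix s2 assume ag2: "agree (mods (Append ''r'' (var ''a''))) (store ''r'' 0 a s') s2"
        and r2: "s2 ''r'' 0 = a * q + a"
      have eq2: "ready s2" "s2 ''a'' 0 = a" "s2 ''z'' = s' ''z''"
        using ag2 r i ready_agree[OF ag2] by (simp_all add: agree_def)
      let ?b = "Plus (Minus (Read ''add'' (var ''r'')) (var ''a'')) (Minus (var ''a'') (Read ''add'' (var ''r'')))"
      have "a \<oplus> a = a \<longleftrightarrow> a = \<zero>" using a by (intro double_eq_self) (simp add: mem_carrier)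
      moreover have "s2 ''add'' (a * q + a) = a \<oplus> a" using eq2(1) a by (simp add: ready_def)
      then have "eval_exp ?b s2 = 0 \<longleftrightarrow> a \<oplus> a = a" using r2 eq2(2) by auto
      ultimately have b: "eval_exp ?b s2 = 0 \<longleftrightarrow> a = \<zero>" by simp
      have "run ?test s2 (1 + cost_exp ?b + 1 + (1 + cost_exp (Const 0) + cost_exp (var ''a''))) (?I (Suc a))"
      proof (rule run_Cond)
        assume "eval_exp ?b s2 \<noteq> 0"
        then have "?I (Suc a) s2" using b I eq2(3) by (metis less_antisym)
        then show "run Skip s2 1 (?I (Suc a))" by (intro run_Skip)
      next
        assume "eval_exp ?b s2 = 0"
        then have "a = \<zero>" using b by blast
        then show "run (assign ''z'' (var ''a'')) s2 (1 + cost_exp (Const 0) + cost_exp (var ''a'')) (?I (Suc a))"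
          using eq2(2) by (intro run_Write) (simp del: One_nat_def)
      qed
      then show "run ?test s2 30 (?I (Suc a))" by (rule run_le) simp
    qed (use r i q_less in \<open>auto simp: ready_def agree_def\<close>)
  next
    fix s' assume "agree (insert ''a'' (mods ?c)) s s'"
    then show "eval_exp (var ''q'') s' = q" using ready by (simp add: agree_def ready_def)
  qed (use q_less zero_less_q K_bounds(1) in auto)
  show ?thesis
    unfolding Zero_def
  proof (rule run_le, rule run_Seq[OF find])
    fix s1 assume ag1: "agree (mods (For ''a'' (var ''q'') ?c)) s s1" and z: "s1 ''z'' 0 = \<zero>"
    have eq1: "ready s1" "s1 ''t'' 0 = t" "s1 ''U'' = (\<lambda>_. 0)" "s1 ''o'' 0 = 0"
      using ag1 assms ready_agree[OF ag1] by (simp_all add: agree_def)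
    let ?s1 = "store ''y'' 0 0 s1"
    have enc: "run ?enc ?s1 (K * (70 * K)) (\<lambda>s'. s' ''y'' 0 = zero_code)"
    proof (rule run_For[where I = "\<lambda>i s'. s' ''y'' 0 = undigits q (\<lambda>_. \<zero>) i"])
      fix i s' assume ag: "agree (insert ''p'' (mods (Append ''y'' (var ''z'')))) ?s1 s'"
        and I: "s' ''y'' 0 = undigits q (\<lambda>_. \<zero>) i"
      have eq: "ready s'" "s' ''z'' 0 = \<zero>"
        using ag eq1 z ready_agree[OF ag] by (simp_all add: agree_def)
      have "run (Append ''y'' (var ''z'')) s' (50 * K) (\<lambda>s'. s' ''y'' 0 = undigits q (\<lambda>_. \<zero>) i * q + \<zero>)"
        by (rule run_Append) (use eq I q_less in \<open>auto simp: ready_def agree_def\<close>)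
      then show "run (Append ''y'' (var ''z'')) s' (50 * K) (\<lambda>s'. s' ''y'' 0 = undigits q (\<lambda>_. \<zero>) (Suc i))"
        by (simp add: add.commute)
    next
      fix s' assume "agree (insert ''p'' (mods (Append ''y'' (var ''z'')))) ?s1 s'"
      then show "eval_exp (var ''d'') s' = d" using eq1(1) by (simp add: agree_def ready_def)
    qed (use d_less K_bounds(1) in \<open>auto simp: zero_code_def\<close>)
    have rest: "run (Seq ?enc ?end) ?s1 (K * (70 * K) + (1 + cost_exp (var ''y'') + cost_exp (Plus (var ''t'') (Const 1)))) (greedy_inv 0)"
    proof (rule run_Seq[OF enc])
      fix s2 assume ag2: "agree (mods ?enc) ?s1 s2" and y: "s2 ''y'' 0 = zero_code"
      have eq2: "ready s2" "s2 ''t'' 0 = t" "s2 ''U'' = (\<lambda>_. 0)" "s2 ''o'' 0 = 0"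
        using ag2 eq1 ready_agree[OF ag2] by (simp_all add: agree_def)
      then show "run ?end s2 (1 + cost_exp (var ''y'') + cost_exp (Plus (var ''t'') (Const 1))) (greedy_inv 0)"
        using y by (intro run_Write) (auto simp: greedy_inv_def)
    qed
    show "run (Seq (assign ''y'' (Const 0)) (Seq ?enc ?end)) s1 (1 + cost_exp (Const 0) + cost_exp (Const 0) +
        (K * (70 * K) + (1 + cost_exp (var ''y'') + cost_exp (Plus (var ''t'') (Const 1))))) (greedy_inv 0)"
      by (rule run_Write_then, rule rest) simp_all
  next
    have "K * (100 * K) = 100 * K ^ 2" "K * (70 * K) = 70 * K ^ 2" by (simp_all add: power2_eq_square)
    then show "K * (100 * K) + (1 + cost_exp (Const 0) + cost_exp (Const 0) +
        (K * (70 * K) + (1 + cost_exp (var ''y'') + cost_exp (Plus (var ''t'') (Const 1))))) \<le> 500 * K ^ 2"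
      using K_bounds unfolding cost_exp.simps by linarith
  qed
qed

text \<open>The loop keeps \<open>Q = q ^ i\<close> while the cell \<open>d\<close> holds
  \<open>i\<close>, starting from its initial value 0. The assumed equivalence makes the test true
  for \<open>i < d\<close> and false at \<open>d\<close>.\<close>

lemma run_Dim:
  assumes s: "s ''q'' 0 = q" "s ''n'' 0 = n" "s ''t'' 0 = t" "s ''d'' 0 = 0"
  shows "run Dim s (500 * K ^ 2) (\<lambda>s'. s' ''Q'' 0 = q ^ d \<and> s' ''d'' 0 = d)"
proof -
  let ?e = "Minus (Plus (var ''t'') (var ''t'')) (Const 1)"
  let ?b = "Minus (var ''M'') (var ''Q'')"
  let ?c = "Seq (Mult ''Q'' ''q'') (assign ''d'' (Plus (var ''d'') (Const 1)))"
  let ?M = "(n * q) ^ (2 * t - 1)"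
  let ?Q = "\<lambda>s'. s' ''Q'' 0 = q ^ d \<and> s' ''d'' 0 = d"
  have while: "run (While ?b ?c) s1 (d * (1 + cost_exp ?b + (30 * K + (1 + cost_exp (Const 0) +
      cost_exp (Plus (var ''d'') (Const 1))))) + (1 + cost_exp ?b)) ?Q"
    if "s1 ''q'' 0 = q" "s1 ''M'' 0 = ?M" "s1 ''Q'' 0 = 1" "s1 ''d'' 0 = 0" for s1
  proof (rule run_While[where I = "\<lambda>i s'. s' ''Q'' 0 = q ^ i \<and> s' ''d'' 0 = i"])
    fix i s' assume i: "i < d" and ag: "agree (mods ?c) s1 s'" and I: "s' ''Q'' 0 = q ^ i \<and> s' ''d'' 0 = i"
    have eq: "s' ''q'' 0 = q" "s' ''M'' 0 = ?M" using ag that by (simp_all add: agree_def)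
    have "q ^ i < ?M" using d[of i] i by simp
    moreover have "run ?c s' (30 * K + (1 + cost_exp (Const 0) + cost_exp (Plus (var ''d'') (Const 1))))
        (\<lambda>s'. s' ''Q'' 0 = q ^ Suc i \<and> s' ''d'' 0 = Suc i)"
    proof (rule run_Seq[OF run_Mult])
      fix s2 assume "agree (mods (Mult ''Q'' ''q'')) s' s2" and "s2 ''Q'' 0 = q ^ i * q"
      then show "run (assign ''d'' (Plus (var ''d'') (Const 1))) s2 (1 + cost_exp (Const 0) + cost_exp (Plus (var ''d'') (Const 1)))
          (\<lambda>s'. s' ''Q'' 0 = q ^ Suc i \<and> s' ''d'' 0 = Suc i)"
        using I by (intro run_Write) (simp add: agree_def)
    qed (use eq I q_less in auto)
    ultimately show "eval_exp ?b s' \<noteq> 0 \<and> run ?c s' (30 * K + (1 + cost_exp (Const 0) +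
        cost_exp (Plus (var ''d'') (Const 1)))) (\<lambda>s'. s' ''Q'' 0 = q ^ Suc i \<and> s' ''d'' 0 = Suc i)"
      using eq I by simp
  next
    fix s' assume ag: "agree (mods ?c) s1 s'" and I: "s' ''Q'' 0 = q ^ d \<and> s' ''d'' 0 = d"
    have "s' ''M'' 0 = ?M" using ag that by (simp add: agree_def)
    then show "eval_exp ?b s' = 0 \<and> ?Q s'" using I d[of d] by simp
  qed (use that in auto)
  have power: "run (For ''i'' ?e (Mult ''M'' ''b'')) s1 (K * (50 * K)) (\<lambda>s'. s' ''M'' 0 = ?M)"
    if "s1 ''t'' 0 = t" "s1 ''b'' 0 = n * q" "s1 ''M'' 0 = 1" for s1
  proof (rule run_For[where I = "\<lambda>i s'. s' ''M'' 0 = (n * q) ^ i"])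
    fix i s' assume ag: "agree (insert ''i'' (mods (Mult ''M'' ''b''))) s1 s'" and I: "s' ''M'' 0 = (n * q) ^ i"
    have "s' ''b'' 0 = n * q" using ag that by (simp add: agree_def)
    then have "run (Mult ''M'' ''b'') s' (30 * K) (\<lambda>s'. s' ''M'' 0 = (n * q) ^ i * (n * q))"
      using I nq_less by (intro run_Mult) auto
    then show "run (Mult ''M'' ''b'') s' (30 * K) (\<lambda>s'. s' ''M'' 0 = (n * q) ^ Suc i)"
      by (simp add: mult.commute)
  next
    fix s' assume "agree (insert ''i'' (mods (Mult ''M'' ''b''))) s1 s'"
    then show "eval_exp ?e s' = 2 * t - 1" using that by (simp add: agree_def)
  qed (use that t_less K_bounds(1) in auto)
  let ?T = "d * (1 + cost_exp ?b + (30 * K + (1 + cost_exp (Const 0) +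
      cost_exp (Plus (var ''d'') (Const 1))))) + (1 + cost_exp ?b)"
  let ?c2 = "Seq (assign ''Q'' (Const 1)) (While ?b ?c)"
  let ?c1 = "Seq (assign ''M'' (Const 1)) (Seq (For ''i'' ?e (Mult ''M'' ''b'')) ?c2)"
  let ?T2 = "1 + cost_exp (Const 0) + cost_exp (Const 1) + ?T"
  let ?T1 = "1 + cost_exp (Const 0) + cost_exp (Const 1) + (K * (50 * K) + ?T2)"
  show ?thesis
    unfolding Dim_def
  proof (rule run_le, rule run_Write_then, rule run_Seq[OF run_Mult[where a = n and b = q and K = K]])
    fix s1 assume ag1: "agree (mods (Mult ''b'' ''q'')) (store ''b'' 0 n s) s1" and b: "s1 ''b'' 0 = n * q"
    have eq1: "s1 ''q'' 0 = q" "s1 ''t'' 0 = t" "s1 ''d'' 0 = 0" using ag1 s by (simp_all add: agree_def)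
    show "run ?c1 s1 ?T1 ?Q"
    proof (rule run_Write_then, rule run_Seq[OF power])
      fix s2 assume ag2: "agree (mods (For ''i'' ?e (Mult ''M'' ''b''))) (store ''M'' 0 1 s1) s2" and M: "s2 ''M'' 0 = ?M"
      have eq2: "s2 ''q'' 0 = q" "s2 ''d'' 0 = 0" using ag2 eq1 by (simp_all add: agree_def)
      show "run ?c2 s2 ?T2 ?Q"
        by (rule run_Write_then[where a = 0 and b = 1], rule while) (use eq2 M in simp_all)
    qed (use eq1 b in auto)
  next
    have "?T \<le> K * (1 + cost_exp ?b + (30 * K + (1 + cost_exp (Const 0) +
        cost_exp (Plus (var ''d'') (Const 1))))) + (1 + cost_exp ?b)"
      using d_less by (intro add_mono mult_le_mono) auto
    also have "\<dots> = 30 * K ^ 2 + 12 * K + 6"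
      by (simp add: algebra_simps power2_eq_square)
    finally have T: "?T \<le> 30 * K ^ 2 + 12 * K + 6" .
    have "K * (50 * K) = 50 * K ^ 2" by (simp add: power2_eq_square)
    then have "1 + 1 + 2 + (30 * K + (1 + 1 + 1 + (K * (50 * K) + (1 + 1 + 1 + ?T)))) \<le> 500 * K ^ 2"
      using K_bounds T by linarith
    then show "1 + cost_exp (Const 0) + cost_exp (var ''n'') + (30 * K + ?T1) \<le> 500 * K ^ 2"
      by simp
  qed (use s q_less in auto)
qed

text \<open>The chosen vectors, the table entries, the scalars, the digits and the additions
  simulating one product each contribute a factor \<open>K\<close>.\<close>

lemma run_Construct: "run Construct (input F q t n) (2000 * K ^ 5) (greedy_inv n)"
proof -
  let ?s = "input F q t n"
  have table: "a * q + b < q * q" "(a * q + b) div q = a" "(a * q + b) mod q = b" if "a < q" "b < q" for a b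
  proof -
    have "Suc a * q \<le> q * q" using that(1) by (intro mult_le_mono1) simp
    then show "a * q + b < q * q" using that(2) by simp
  qed (use that in auto)
  have s: "?s ''q'' 0 = q" "?s ''n'' 0 = n" "?s ''t'' 0 = t" "?s ''d'' 0 = 0" "?s ''U'' = (\<lambda>_. 0)" "?s ''o'' 0 = 0"
    "\<And>a b. a < q \<Longrightarrow> b < q \<Longrightarrow> ?s ''add'' (a * q + b) = a \<oplus> b \<and> ?s ''mul'' (a * q + b) = a \<otimes> b"
    using table by (auto simp: input_def)
  have loop: "run (For ''i'' (var ''n'') Step) s1 (K * (900 * K ^ 4)) (greedy_inv n)" if inv: "greedy_inv 0 s1" for s1
  proof (rule run_For[where I = greedy_inv])
    show "greedy_inv i (store ''i'' 0 a s') \<longleftrightarrow> greedy_inv i s'" for i a s'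
      by (simp add: greedy_inv_def)
    show "run Step s' (800 * K ^ 4) (greedy_inv (Suc i))"
      if "i < n" "s' ''i'' 0 = i" "greedy_inv i s'" for i s'
      using that by (rule run_Step)
    show "eval_exp (var ''n'') s' = n" if "agree (insert ''i'' (mods Step)) s1 s'" for s'
      using that inv by (simp add: agree_def greedy_inv_def ready_def)
    show "800 * K ^ 4 + cost_exp (var ''n'') + 10 \<le> 900 * K ^ 4"
      using K_bounds unfolding cost_exp.simps by linarith
  qed (use inv n_less in auto)
  show ?thesis
    unfolding Construct_def
  proof (rule run_le, rule run_Seq[OF run_Dim])
    fix s1 assume ag: "agree (mods Dim) ?s s1" and "s1 ''Q'' 0 = q ^ d \<and> s1 ''d'' 0 = d"
    then have "ready s1" "s1 ''t'' 0 = t" "s1 ''U'' = (\<lambda>_. 0)" "s1 ''o'' 0 = 0"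
      using s by (simp_all add: ready_def agree_def)
    then show "run (Seq Zero (For ''i'' (var ''n'') Step)) s1 (500 * K ^ 2 + K * (900 * K ^ 4)) (greedy_inv n)"
      by (intro run_Seq[OF run_Zero loop])
  next
    have "K * (900 * K ^ 4) = 900 * K ^ 5" using power_Suc[of K 4] by simp
    then show "500 * K ^ 2 + (500 * K ^ 2 + K * (900 * K ^ 4)) \<le> 2000 * K ^ 5"
      using K_bounds by linarith
  qed (use s in auto)
qed

end

section \<open>The dimension\<close>

text \<open>Take logarithms and divide by \<open>ln q\<close>: the factor \<open>q\<close> inside
  \<open>(n * q) ^ (2 * t - 1)\<close> produces the summand \<open>2 * t - 1\<close>, and the
  ceiling turns a real lower bound on \<open>e\<close> into the least admissible integer.\<close>

lemma dimension_le_iff: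
  fixes q t n d e :: nat
  assumes "2 \<le> q" "1 \<le> t" "1 \<le> n"
    and d: "d = nat \<lceil>(2 * real t - 1) * ln (real n) / ln (real q) + 2 * real t - 1\<rceil>"
  shows "(n * q) ^ (2 * t - 1) \<le> q ^ e \<longleftrightarrow> d \<le> e"
proof -
  let ?m = "2 * real t - 1"
  have lnq: "0 < ln (real q)" using assms(1) by simp
  have m: "real (2 * t - 1) = ?m" using assms(2) by (simp add: of_nat_diff)
  have "(n * q) ^ (2 * t - 1) \<le> q ^ e \<longleftrightarrow> (real n * real q) ^ (2 * t - 1) \<le> real q ^ e"
    by (metis of_nat_le_iff of_nat_mult of_nat_power)
  also have "\<dots> \<longleftrightarrow> ln ((real n * real q) ^ (2 * t - 1)) \<le> ln (real q ^ e)"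
    using assms by (subst ln_le_cancel_iff) auto
  also have "\<dots> \<longleftrightarrow> ?m * (ln (real n) + ln (real q)) \<le> real e * ln (real q)"
    using assms by (simp add: ln_realpow ln_mult m)
  also have "\<dots> \<longleftrightarrow> ?m * ln (real n) / ln (real q) + 2 * real t - 1 \<le> real e"
    using lnq by (simp add: field_simps)
  also have "\<dots> \<longleftrightarrow> d \<le> e"
    unfolding d nat_le_iff ceiling_le_iff by simp
  finally show ?thesis .
qed

lemma le_powr_dimension:
  fixes q t n d :: nat
  assumes "2 \<le> q" "1 \<le> t" "1 \<le> n"
    and d: "d = nat \<lceil>(2 * real t - 1) * ln (real n) / ln (real q) + 2 * real t - 1\<rceil>"
  shows "real n \<le> real q powr ((real d - (2 * real t - 1)) / (2 * real t - 1))"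
proof -
  let ?m = "2 * real t - 1"
  have lnq: "0 < ln (real q)" and m: "0 < ?m" using assms(1,2) by auto
  have "?m * ln (real n) / ln (real q) + 2 * real t - 1 \<le> real d"
    unfolding d by linarith
  then have "?m * ln (real n) / ln (real q) \<le> real d - ?m" by simp
  then have "?m * ln (real n) \<le> (real d - ?m) * ln (real q)"
    using lnq by (simp add: pos_divide_le_eq)
  then have "ln (real n) \<le> (real d - ?m) / ?m * ln (real q)"
    using m by (simp add: pos_le_divide_eq mult.commute)
  then have "exp (ln (real n)) \<le> exp ((real d - ?m) / ?m * ln (real q))" by simp
  then show ?thesis using assms by (simp add: powr_def)
qed

text \<open>By minimality of \<open>d\<close>, which is not 0, \<open>q ^ d\<close> is at most
  \<open>q\<close> times \<open>(n * q) ^ (2 * t - 1)\<close>. With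
  \<open>N = n ^ t + q ^ t\<close>, the first factor is at most \<open>N\<close> and the second at
  most \<open>(n ^ t) ^ 2 * (q ^ t) ^ 2\<close> \<le> \<open>N ^ 4\<close>, whence the exponent
  5.\<close>

lemma power_dimension_le:
  fixes q t n d :: nat
  assumes "2 \<le> q" "1 \<le> t" "1 \<le> n" and d: "\<And>e. (n * q) ^ (2 * t - 1) \<le> q ^ e \<longleftrightarrow> d \<le> e"
  shows "q ^ d \<le> (n ^ t + q ^ t) ^ 5"
proof -
  let ?N = "n ^ t + q ^ t"
  have "2 \<le> n * q" using mult_le_mono[OF assms(3,1)] by simp
  also have "\<dots> \<le> (n * q) ^ (2 * t - 1)"
    using power_increasing[of 1 "2 * t - 1" "n * q"] assms by simp
  finally have "d \<noteq> 0" using d[of 0] by auto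
  then obtain e where e: "d = Suc e" by (cases d) auto
  then have "q ^ d \<le> q * (n * q) ^ (2 * t - 1)" using d[of e] by simp
  also have "\<dots> \<le> ?N * (?N ^ 2 * ?N ^ 2)"
  proof (rule mult_le_mono)
    have "q \<le> q ^ t" using assms(1,2) by (intro self_le_power) auto
    then show "q \<le> ?N" by simp
    have "(n * q) ^ (2 * t - 1) \<le> (n * q) ^ (t * 2)"
      using assms by (intro power_increasing) auto
    also have "\<dots> = (n ^ t) ^ 2 * (q ^ t) ^ 2"
      by (simp add: power_mult_distrib power_mult)
    also have "\<dots> \<le> ?N ^ 2 * ?N ^ 2" by (intro mult_le_mono power_mono) auto
    finally show "(n * q) ^ (2 * t - 1) \<le> ?N ^ 2 * ?N ^ 2" .
  qed
  also have "\<dots> = ?N ^ 5" by (simp add: power_add[symmetric] power_Suc[symmetric] del: power_Suc)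
  finally show ?thesis .
qed

theorem theorem2:
  shows "\<exists>(P :: com) (p :: nat poly).
    \<forall>(F :: nat ring) (q :: nat) (t :: nat) (n :: nat) (d :: nat).
      field F \<and> carrier F = {..<q} \<and> t \<ge> 1 \<and> n \<ge> 1 \<and>
      d = nat \<lceil>(2 * real t - 1) * ln (real n) / ln (real q) + 2 * real t - 1\<rceil> \<longrightarrow>
      real n \<le> real q powr ((real d - (2 * real t - 1)) / (2 * real t - 1)) \<and>
      (\<exists>k s. exec P (input F q t n) k s \<and> k \<le> poly p (n ^ t + q ^ t) \<and>
        output_set s n d \<subseteq> carrier (coord_space F d) \<and>
        card (output_set s n d) = n \<and>
        term_lin_indpt F d t (output_set s n d))"
proof (intro exI[of _ Construct] exI[of _ "[:2000:] * (1 + monom 1 5) ^ 5"] allI impI, elim conjE)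
  fix F :: "nat ring" and q t n d :: nat
  assume F: "field F" "carrier F = {..<q}" and t: "1 \<le> t" and n: "1 \<le> n"
    and d: "d = nat \<lceil>(2 * real t - 1) * ln (real n) / ln (real q) + 2 * real t - 1\<rceil>"
  interpret C: coded_field F q d t
    by (intro coded_field.intro coded_field_axioms.intro F)
  have q: "2 \<le> q" using C.q_gt_1 by simp
  \<comment> \<open>The summand 1 makes \<open>q ^ d < K\<close> strict. Inserted into the time
    \<open>2000 * K ^ 5\<close>, this \<open>K\<close> gives the witness polynomial, of degree
    25.\<close>
  define K where "K = 1 + (n ^ t + q ^ t) ^ 5"
  note d_iff = dimension_le_iff[OF q t n d]
  interpret G: greedy F q d t n K
    by unfold_locales
      (use t n d_iff power_dimension_le[OF q t n d_iff] in \<open>auto simp: K_def less_Suc_eq_le\<close>)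
  obtain k s where s: "exec Construct (input F q t n) k s" "k \<le> 2000 * K ^ 5" "G.greedy_inv n s"
    using G.run_Construct unfolding run_def by blast
  interpret V: free_sequence F q d t "s ''V''" n
    by unfold_locales (use t s(3) in \<open>auto simp: G.greedy_inv_def\<close>)
  have "vec d (\<lambda>j. s ''S'' (i * d + j)) = V.W i" if "i < n" for i
    using s(3) that by (auto simp: G.greedy_inv_def V.W_def)
  then have out: "output_set s n d = V.W ` {..<n}"
    unfolding output_set_def by (intro image_cong) auto
  have "k \<le> poly ([:2000:] * (1 + monom 1 5) ^ 5) (n ^ t + q ^ t)"
    using s(2) by (simp add: K_def poly_monom)
  moreover have "output_set s n d \<subseteq> carrier (coord_space F d)"
    unfolding out using V.W_carrier by auto
  moreover have "card (output_set s n d) = n"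
    unfolding out using card_image[OF V.inj_W] by simp
  moreover have "term_lin_indpt F d t (output_set s n d)"
    unfolding out by (rule V.term_lin_indpt_W)
  ultimately show "real n \<le> real q powr ((real d - (2 * real t - 1)) / (2 * real t - 1)) \<and>
      (\<exists>k s. exec Construct (input F q t n) k s \<and> k \<le> poly ([:2000:] * (1 + monom 1 5) ^ 5) (n ^ t + q ^ t) \<and>
        output_set s n d \<subseteq> carrier (coord_space F d) \<and>
        card (output_set s n d) = n \<and>
        term_lin_indpt F d t (output_set s n d))"
    using le_powr_dimension[OF q t n d] s(1) by blast
qed

end
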